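(* Let $\mathcal{L}^\wedge$ be any set of sequents in the language without $\vee$ such that $\mathbf{ACT}^\wedge \subseteq \mathcal{L}^\wedge \subseteq \mathbf{ACT}_\omega^\wedge$. Then $\mathcal{L}^\wedge$ is undecidable. Moreover, if $\mathcal{L}^\wedge$ is recursively enumerable, then it is $\Sigma_1^0$-complete.
   Context: Formulae are built from propositional variables and constants $\mathbf{0},\mathbf{1}$ using binary connectives $\cdot$, $\backslash$, $/$, $\vee$, $\wedge$ and unary ${}^*$. A sequent is $\Gamma\vdash\beta$ with $\Gamma$ a finite, possibly empty (denoted $\Lambda$), sequence of formulae and $\beta$ a formula. The calculus $\mathbf{MALC}$ has axioms $\alpha\vdash\alpha$, $\Gamma,\mathbf{0},\Delta\vdash\gamma$, $\Lambda\vdash\mathbf{1}$, and rules: from $\Gamma,\Delta\vdash\gamma$ infer $\Gamma,\mathbf{1},\Delta\vdash\gamma$; from $\Pi\vdash\alpha$ and $\Gamma,\beta,\Delta\vdash\gamma$ infer $\Gamma,\Pi,\alpha\backslash\beta,\Delta\vdash\gamma$ and also $\Gamma,\beta/\alpha,\Pi,\Delta\vdash\gamma$; from $\alpha,\Pi\vdash\beta$ infer $\Pi\vdash\alpha\backslash\beta$; from $\Pi,\alpha\vdash\beta$ infer $\Pi\vdash\beta/\alpha$; from $\Gamma,\alpha,\beta,\Delta\vdash\gamma$ infer $\Gamma,\alpha\cdot\beta,\Delta\vdash\gamma$; from $\Gamma\vdash\alpha$ and $\Delta\vdash\beta$ infer $\Gamma,\Delta\vdash\alpha\cdot\beta$;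 from $\Gamma,\alpha_i,\Delta\vdash\gamma$ ($i=1,2$) infer $\Gamma,\alpha_1\wedge\alpha_2,\Delta\vdash\gamma$; from $\Pi\vdash\alpha_1$ and $\Pi\vdash\alpha_2$ infer $\Pi\vdash\alpha_1\wedge\alpha_2$; from $\Gamma,\alpha_1,\Delta\vdash\gamma$ and $\Gamma,\alpha_2,\Delta\vdash\gamma$ infer $\Gamma,\alpha_1\vee\alpha_2,\Delta\vdash\gamma$; from $\Pi\vdash\alpha_i$ ($i=1,2$) infer $\Pi\vdash\alpha_1\vee\alpha_2$. Action logic $\mathbf{ACT}$ is $\mathbf{MALC}$ extended with: from $\Lambda\vdash\beta$ and $\alpha,\beta\vdash\beta$ infer $\alpha^*\vdash\beta$; cut (from $\Pi\vdash\alpha$ and $\Gamma,\alpha,\Delta\vdash\gamma$ infer $\Gamma,\Pi,\Delta\vdash\gamma$); the axiom $\Lambda\vdash\alpha^*$; from $\Pi\vdash\alpha$ and $\Delta\vdash\alpha^*$ infer $\Pi,\Delta\vdash\alpha^*$. Infinitary action logic $\mathbf{ACT}_\omega$ is $\mathbf{MALC}$ extended with the $\omega$-rule: from $\Gamma,\alpha^n,\Delta\vdash\gamma$ for all $n\in\omega$ infer $\Gamma,\alpha^*,\Delta\vdash\gamma$ ($\alpha^n$ = $n$ consecutive copies of $\alpha$), and, for each $n\ge0$, from $\Pi_1\vdash\alpha,\dots,\Pi_n\vdash\alpha$ infer $\Pi_1,\dots,\Pi_n\vdash\alpha^*$; derivations are possibly infinite well-founded trees. $\mathbf{ACT}^\wedge$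 is the set of $\vee$-free sequents derivable in the calculus obtained from $\mathbf{ACT}$ by deleting the two rules for $\vee$ (the logic of action meet-semilattices). $\mathbf{ACT}_\omega^\wedge$ is the set of $\vee$-free sequents derivable in $\mathbf{ACT}_\omega$ (equivalently, in $\mathbf{ACT}_\omega$ without the $\vee$ rules). Logics are sets of sequents; inclusions are set inclusions. $\Sigma_1^0$-complete means r.e. and every r.e. set is many-one reducible to it. *)

theory Defs
  imports Main "HOL-Library.Nat_Bijection"
begin

section \<open>Formulae and sequents\<close>

text \<open>\<open>LDiv \<alpha> \<beta>\<close> is $\alpha \backslash \beta$ and \<open>RDiv \<beta> \<alpha>\<close> is $\beta / \alpha$.\<close>

datatype form =
    Var nat
  | Zero
  | One
  | Mult form form
  | LDiv form form
  | RDiv form form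
  | Join form form
  | Meet form form
  | Star form

type_synonym sequent = "form list \<times> form"

abbreviation sequent :: "form list \<Rightarrow> form \<Rightarrow> sequent"  (infix "\<turnstile>" 55)
  where "\<Gamma> \<turnstile> \<beta> \<equiv> (\<Gamma>, \<beta>)"

primrec join_free_form :: "form \<Rightarrow> bool" where
  "join_free_form (Var n) = True"
| "join_free_form Zero = True"
| "join_free_form One = True"
| "join_free_form (Mult a b) = (join_free_form a \<and> join_free_form b)"
| "join_free_form (LDiv a b) = (join_free_form a \<and> join_free_form b)"
| "join_free_form (RDiv a b) = (join_free_form a \<and> join_free_form b)"
| "join_free_form (Join a b) = False"
| "join_free_form (Meet a b) = (join_free_form a \<and> join_free_form b)"
| "join_free_form (Star a) = join_free_form a"

definition join_free :: "sequent \<Rightarrow> bool" where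
  "join_free s \<longleftrightarrow> (\<forall>\<alpha>\<in>set (fst s). join_free_form \<alpha>) \<and> join_free_form (snd s)"

section \<open>Calculi\<close>

text \<open>A calculus is a set of rule instances, each given by its set of premises, possibly empty
  (axioms) or infinite, and its conclusion. Derivations are well-founded trees, so derivability
  is the inductive closure under the rule instances.\<close>

type_synonym inference = "sequent set \<times> sequent"

inductive_set derivable :: "inference set \<Rightarrow> sequent set" for R where
  infer: "(P, s) \<in> R \<Longrightarrow> (\<And>p. p \<in> P \<Longrightarrow> p \<in> derivable R) \<Longrightarrow> s \<in> derivable R"

inductive_set MALC_without_join :: "inference set" where
  ax:       "({}, [\<alpha>] \<turnstile> \<alpha>) \<in> MALC_without_join"
| zero_L:   "({}, \<Gamma> @ [Zero] @ \<Delta> \<turnstile> \<gamma>) \<in> MALC_without_join"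
| one_R:    "({}, [] \<turnstile> One) \<in> MALC_without_join"
| one_L:    "({\<Gamma> @ \<Delta> \<turnstile> \<gamma>}, \<Gamma> @ [One] @ \<Delta> \<turnstile> \<gamma>) \<in> MALC_without_join"
| ldiv_L:   "({\<Pi> \<turnstile> \<alpha>, \<Gamma> @ [\<beta>] @ \<Delta> \<turnstile> \<gamma>}, \<Gamma> @ \<Pi> @ [LDiv \<alpha> \<beta>] @ \<Delta> \<turnstile> \<gamma>) \<in> MALC_without_join"
| rdiv_L:   "({\<Pi> \<turnstile> \<alpha>, \<Gamma> @ [\<beta>] @ \<Delta> \<turnstile> \<gamma>}, \<Gamma> @ [RDiv \<beta> \<alpha>] @ \<Pi> @ \<Delta> \<turnstile> \<gamma>) \<in> MALC_without_join"
| ldiv_R:   "({[\<alpha>] @ \<Pi> \<turnstile> \<beta>}, \<Pi> \<turnstile> LDiv \<alpha> \<beta>) \<in> MALC_without_join"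
| rdiv_R:   "({\<Pi> @ [\<alpha>] \<turnstile> \<beta>}, \<Pi> \<turnstile> RDiv \<beta> \<alpha>) \<in> MALC_without_join"
| mult_L:   "({\<Gamma> @ [\<alpha>, \<beta>] @ \<Delta> \<turnstile> \<gamma>}, \<Gamma> @ [Mult \<alpha> \<beta>] @ \<Delta> \<turnstile> \<gamma>) \<in> MALC_without_join"
| mult_R:   "({\<Gamma> \<turnstile> \<alpha>, \<Delta> \<turnstile> \<beta>}, \<Gamma> @ \<Delta> \<turnstile> Mult \<alpha> \<beta>) \<in> MALC_without_join"
| meet_L1:  "({\<Gamma> @ [\<alpha>\<^sub>1] @ \<Delta> \<turnstile> \<gamma>}, \<Gamma> @ [Meet \<alpha>\<^sub>1 \<alpha>\<^sub>2] @ \<Delta> \<turnstile> \<gamma>) \<in> MALC_without_join"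
| meet_L2:  "({\<Gamma> @ [\<alpha>\<^sub>2] @ \<Delta> \<turnstile> \<gamma>}, \<Gamma> @ [Meet \<alpha>\<^sub>1 \<alpha>\<^sub>2] @ \<Delta> \<turnstile> \<gamma>) \<in> MALC_without_join"
| meet_R:   "({\<Pi> \<turnstile> \<alpha>\<^sub>1, \<Pi> \<turnstile> \<alpha>\<^sub>2}, \<Pi> \<turnstile> Meet \<alpha>\<^sub>1 \<alpha>\<^sub>2) \<in> MALC_without_join"

inductive_set join_rules :: "inference set" where
  join_L:   "({\<Gamma> @ [\<alpha>\<^sub>1] @ \<Delta> \<turnstile> \<gamma>, \<Gamma> @ [\<alpha>\<^sub>2] @ \<Delta> \<turnstile> \<gamma>}, \<Gamma> @ [Join \<alpha>\<^sub>1 \<alpha>\<^sub>2] @ \<Delta> \<turnstile> \<gamma>) \<in> join_rules"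
| join_R1:  "({\<Pi> \<turnstile> \<alpha>\<^sub>1}, \<Pi> \<turnstile> Join \<alpha>\<^sub>1 \<alpha>\<^sub>2) \<in> join_rules"
| join_R2:  "({\<Pi> \<turnstile> \<alpha>\<^sub>2}, \<Pi> \<turnstile> Join \<alpha>\<^sub>1 \<alpha>\<^sub>2) \<in> join_rules"

definition MALC :: "inference set" where
  "MALC = MALC_without_join \<union> join_rules"

inductive_set action_rules :: "inference set" where
  star_ind:  "({[] \<turnstile> \<beta>, [\<alpha>, \<beta>] \<turnstile> \<beta>}, [Star \<alpha>] \<turnstile> \<beta>) \<in> action_rules"
| cut:       "({\<Pi> \<turnstile> \<alpha>, \<Gamma> @ [\<alpha>] @ \<Delta> \<turnstile> \<gamma>}, \<Gamma> @ \<Pi> @ \<Delta> \<turnstile> \<gamma>) \<in> action_rules"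
| star_nil:  "({}, [] \<turnstile> Star \<alpha>) \<in> action_rules"
| star_cons: "({\<Pi> \<turnstile> \<alpha>, \<Delta> \<turnstile> Star \<alpha>}, \<Pi> @ \<Delta> \<turnstile> Star \<alpha>) \<in> action_rules"

inductive_set omega_rules :: "inference set" where
  star_L_omega: "(range (\<lambda>n. \<Gamma> @ replicate n \<alpha> @ \<Delta> \<turnstile> \<gamma>), \<Gamma> @ [Star \<alpha>] @ \<Delta> \<turnstile> \<gamma>) \<in> omega_rules"
| star_R:       "((\<lambda>\<Pi>. \<Pi> \<turnstile> \<alpha>) ` set \<Pi>s, concat \<Pi>s \<turnstile> Star \<alpha>) \<in> omega_rules"

definition ACT_calculus :: "inference set" where
  "ACT_calculus = MALC \<union> action_rules"

definition ACT_without_join :: "inference set" where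
  "ACT_without_join = MALC_without_join \<union> action_rules"

definition ACT_omega_calculus :: "inference set" where
  "ACT_omega_calculus = MALC \<union> omega_rules"

definition ACT_meet :: "sequent set" where
  "ACT_meet = {s \<in> derivable ACT_without_join. join_free s}"

definition ACT_omega_meet :: "sequent set" where
  "ACT_omega_meet = {s \<in> derivable ACT_omega_calculus. join_free s}"

section \<open>Recursive functions\<close>

text \<open>Terms for partial recursive functions and their graphs: \<open>rec_eval r xs y\<close> says that
  \<open>r\<close> converges to \<open>y\<close> on arguments \<open>xs\<close>. Terms carry no arity; on argument lists of a fixed
  length each term denotes a partial recursive function of that arity (nowhere defined if the
  arities do not fit).\<close>

datatype recf =
    RZero
  | RSucc
  | RProj nat
  | RComp recf "recf list"
  | RPrim recf recf
  | RMin recf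

inductive rec_eval :: "recf \<Rightarrow> nat list \<Rightarrow> nat \<Rightarrow> bool" where
  zero: "rec_eval RZero xs 0"
| succ: "rec_eval RSucc [x] (Suc x)"
| proj: "i < length xs \<Longrightarrow> rec_eval (RProj i) xs (xs ! i)"
| comp: "list_all2 (\<lambda>g y. rec_eval g xs y) gs ys \<Longrightarrow> rec_eval f ys z \<Longrightarrow> rec_eval (RComp f gs) xs z"
| prim_0: "rec_eval f xs y \<Longrightarrow> rec_eval (RPrim f g) (0 # xs) y"
| prim_Suc: "rec_eval (RPrim f g) (n # xs) y \<Longrightarrow> rec_eval g (n # y # xs) z
    \<Longrightarrow> rec_eval (RPrim f g) (Suc n # xs) z"
| min: "rec_eval f (n # xs) 0 \<Longrightarrow> (\<forall>m<n. \<exists>k. rec_eval f (m # xs) (Suc k))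
    \<Longrightarrow> rec_eval (RMin f) xs n"

lemma rec_eval_deterministic: "rec_eval r xs y \<Longrightarrow> rec_eval r xs z \<Longrightarrow> y = z"
proof (induction arbitrary: z rule: rec_eval.induct)
  case (comp xs gs ys f y)
  from comp.prems obtain ys' where ys': "list_all2 (\<lambda>g y. rec_eval g xs y) gs ys'" "rec_eval f ys' z"
    by cases auto
  from comp.hyps comp.IH(1) ys'(1) have "ys = ys'"
    by (auto simp: list_all2_conv_all_nth intro!: nth_equalityI)
  with ys'(2) comp.IH show ?case by blast
next
  case (min f n xs)
  from min.prems show ?case
  proof cases
    case min': min
    show ?thesis
    proof (rule linorder_cases[of n z])
      assume "n < z"
      with min'(2) obtain k where "rec_eval f (n # xs) (Suc k)" by blast
      with min.IH(1) have "0 = Suc k" by blast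
      then show ?thesis by simp
    next
      assume "z < n"
      with min.IH(2) min'(1) have "\<exists>k. Suc k = 0" by blast
      then show ?thesis by simp
    qed
  qed
next
  case (prim_0 f xs y g)
  from prim_0.prems show ?case by cases (auto dest: prim_0.IH)
next
  case (prim_Suc f g n xs y z')
  from prim_Suc.prems show ?case
  proof cases
    case prim_Suc': (prim_Suc y')
    with prim_Suc.IH(1) have "y = y'" by blast
    with prim_Suc'(2) prim_Suc.IH(2) show ?thesis by blast
  qed
qed (erule rec_eval.cases; simp)+

definition total_recursive :: "(nat \<Rightarrow> nat) \<Rightarrow> bool" where
  "total_recursive f \<longleftrightarrow> (\<exists>r. \<forall>x y. rec_eval r [x] y \<longleftrightarrow> y = f x)"

definition decidable :: "nat set \<Rightarrow> bool" where
  "decidable A \<longleftrightarrow> total_recursive (\<lambda>x. if x \<in> A then 1 else 0)"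

definition recursively_enumerable :: "nat set \<Rightarrow> bool" where
  "recursively_enumerable A \<longleftrightarrow> (\<exists>r. A = {x. \<exists>y. rec_eval r [x] y})"

definition many_one_reducible :: "nat set \<Rightarrow> nat set \<Rightarrow> bool" where
  "many_one_reducible A B \<longleftrightarrow> (\<exists>f. total_recursive f \<and> (\<forall>x. x \<in> A \<longleftrightarrow> f x \<in> B))"

definition Sigma_0_1_complete :: "nat set \<Rightarrow> bool" where
  "Sigma_0_1_complete B \<longleftrightarrow> recursively_enumerable B \<and>
     (\<forall>A. recursively_enumerable A \<longrightarrow> many_one_reducible A B)"

section \<open>Goedel numbering of sequents\<close>

text \<open>The numbering is a bijection between sequents and natural numbers, so that a set of
  sequents and its set of codes are the same decision problem.\<close>

primrec form_code :: "form \<Rightarrow> nat" where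
  "form_code Zero = 0"
| "form_code One = 1"
| "form_code (Var n) = 2 + 7 * n"
| "form_code (Mult a b) = 3 + 7 * prod_encode (form_code a, form_code b)"
| "form_code (LDiv a b) = 4 + 7 * prod_encode (form_code a, form_code b)"
| "form_code (RDiv a b) = 5 + 7 * prod_encode (form_code a, form_code b)"
| "form_code (Join a b) = 6 + 7 * prod_encode (form_code a, form_code b)"
| "form_code (Meet a b) = 7 + 7 * prod_encode (form_code a, form_code b)"
| "form_code (Star a) = 8 + 7 * form_code a"

definition sequent_code :: "sequent \<Rightarrow> nat" where
  "sequent_code s = prod_encode (list_encode (map form_code (fst s)), form_code (snd s))"

lemma inj_form_code: "form_code a = form_code b \<Longrightarrow> a = b"
proof -
  have residues: "7 * x \<noteq> Suc (7 * y)" "7 * x \<noteq> Suc (Suc (7 * y))" "7 * x \<noteq> 3 + 7 * y"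
    "7 * x \<noteq> 4 + 7 * y" "7 * x \<noteq> 5 + 7 * y" "7 * x \<noteq> 6 + 7 * y" for x y :: nat
    by presburger+
  show "form_code a = form_code b \<Longrightarrow> a = b"
    by (induction a arbitrary: b; case_tac b; simp add: residues residues[symmetric])
qed

lemma surj_form_code: "\<exists>a. form_code a = n"
proof (induction n rule: less_induct)
  case (less n)
  show ?case
  proof (cases "n < 2")
    case True
    then have "form_code Zero = n \<or> form_code One = n" by auto
    then show ?thesis by blast
  next
    case False
    define q where "q = (n - 2) div 7"
    obtain i j where ij: "q = prod_encode (i, j)"
      by (metis prod.exhaust prod_decode_inverse)
    from False have "q < n" by (simp add: q_def)
    moreover have "i \<le> q" "j \<le> q"
      unfolding ij by (simp_all add: le_prod_encode_1 le_prod_encode_2)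
    ultimately have "q < n" "i < n" "j < n" by simp_all
    with less obtain a b c where abc: "form_code a = i" "form_code b = j" "form_code c = q"
      by meson
    from False have "n = 2 + 7 * q \<or> n = 3 + 7 * q \<or> n = 4 + 7 * q \<or> n = 5 + 7 * q
        \<or> n = 6 + 7 * q \<or> n = 7 + 7 * q \<or> n = 8 + 7 * q"
      unfolding q_def by presburger
    then have "n \<in> form_code ` {Var q, Mult a b, LDiv a b, RDiv a b, Join a b, Meet a b, Star c}"
      by (auto simp: abc ij)
    then show ?thesis by blast
  qed
qed

lemma bij_sequent_code: "bij sequent_code"
proof -
  have form: "bij form_code"
    using inj_form_code surj_form_code by (simp add: bij_def inj_def surj_def) metis
  have "bij (list_encode \<circ> map form_code)"
    using form by (intro bij_comp bij_list_encode)
      (simp add: bij_def list.inj_map surj_def, metis ex_map_conv)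
  then have "bij (map_prod (list_encode \<circ> map form_code) form_code)"
    using form by (simp add: bij_def map_prod_surj prod.inj_map)
  then have "bij (prod_encode \<circ> map_prod (list_encode \<circ> map form_code) form_code)"
    by (intro bij_comp bij_prod_encode)
  also have "prod_encode \<circ> map_prod (list_encode \<circ> map form_code) form_code = sequent_code"
    by (auto simp: sequent_code_def fun_eq_iff)
  finally show ?thesis .
qed

end

theory Submission
  imports Defs
begin

text \<open>A counter machine is turned into formulas \<open>start\<close>, \<open>input\<^sub>0\<close>, \<open>input\<^sub>1\<close>, \<open>step\<close> and \<open>end\<close> such that
  the antecedent \<open>start, input\<^sub>0\<^sup>x, input\<^sub>1\<^sup>y, step\<^sup>n\<close> derives precise information on the configuration
  after \<open>n\<close> steps on input \<open>(x, y)\<close>, while the interpretation of formulas as sets of words over the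
  computation histories shows that it derives nothing wrong. Thus
  \<open>start, input\<^sub>0\<^sup>x, input\<^sub>1\<^sup>y, step\<^sup>* \<bullet> end \<turnstile> good\<close> says that the machine never enters the program counter
  \<open>N + 1\<close>, where \<open>N\<close> is the length of its program. If the computation gets trapped in the program
  counter \<open>N\<close>, this is derivable by unfolding the star finitely often and then using the invariant
  ``the program counter is \<open>N\<close>''. If it enters \<open>N + 1\<close>, the language model refutes the sequent even in
  infinitary action logic.

  The program only occurs in the last formula of the antecedent. On the second input the machine
  receives the code of that formula, so that it can compute the code of its own sequent and
  diagonalise against any logic \<open>L\<close> between the two calculi: it is trapped if its input is found in
  a given recursively enumerable set, and it enters \<open>N + 1\<close> if its own sequent is found in \<open>L\<close>
  first.\<close>


section \<open>Language models\<close>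

definition conc :: "'a list set \<Rightarrow> 'a list set \<Rightarrow> 'a list set" where
  "conc A B = {u @ v | u v. u \<in> A \<and> v \<in> B}"

text \<open>The divisions are the residuals of concatenation among all languages. Reading the star
  as finite iteration is what makes the omega rule sound.\<close>

primrec lang :: "(nat \<Rightarrow> 'a list set) \<Rightarrow> form \<Rightarrow> 'a list set" where
  "lang V (Var n) = V n"
| "lang V Zero = {}"
| "lang V One = {[]}"
| "lang V (Mult a b) = conc (lang V a) (lang V b)"
| "lang V (LDiv a b) = {v. \<forall>u\<in>lang V a. u @ v \<in> lang V b}"
| "lang V (RDiv b a) = {v. \<forall>u\<in>lang V a. v @ u \<in> lang V b}"
| "lang V (Join a b) = lang V a \<union> lang V b"
| "lang V (Meet a b) = lang V a \<inter> lang V b"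
| "lang V (Star a) = concat ` lists (lang V a)"

primrec lang_list :: "(nat \<Rightarrow> 'a list set) \<Rightarrow> form list \<Rightarrow> 'a list set" where
  "lang_list V [] = {[]}"
| "lang_list V (a # \<Gamma>) = conc (lang V a) (lang_list V \<Gamma>)"

lemma concI: "u \<in> A \<Longrightarrow> v \<in> B \<Longrightarrow> u @ v \<in> conc A B"
  by (auto simp: conc_def)

lemma conc_assoc: "conc (conc A B) C = conc A (conc B C)"
  unfolding conc_def by (auto, metis append_assoc, metis append_assoc)

lemma conc_Nil [simp]: "conc {[]} A = A" "conc A {[]} = A"
  by (auto simp: conc_def)

lemma conc_mono: "A \<subseteq> A' \<Longrightarrow> B \<subseteq> B' \<Longrightarrow> conc A B \<subseteq> conc A' B'"
  by (auto simp: conc_def)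

lemma lang_list_append: "lang_list V (\<Gamma> @ \<Delta>) = conc (lang_list V \<Gamma>) (lang_list V \<Delta>)"
  by (induction \<Gamma>) (simp_all add: conc_assoc)

text \<open>A word of a starred language has finitely many factors; their number selects the premise
  of the omega rule to be used.\<close>

lemma concat_in_lang_list_replicate:
  "ws \<in> lists (lang V a) \<Longrightarrow> concat ws \<in> lang_list V (replicate (length ws) a)"
  by (induction ws) (auto intro: concI)

lemma lang_list_concat_subset:
  "\<forall>\<Pi>\<in>set \<Pi>s. lang_list V \<Pi> \<subseteq> lang V a \<Longrightarrow> lang_list V (concat \<Pi>s) \<subseteq> lang V (Star a)"
proof (induction \<Pi>s)
  case Nil
  show ?case by (auto intro: image_eqI[where x = "[]"])
next
  case (Cons \<Pi> \<Pi>s)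
  show ?case
  proof
    fix w assume "w \<in> lang_list V (concat (\<Pi> # \<Pi>s))"
    then obtain u v where w: "w = u @ v" "u \<in> lang_list V \<Pi>" "v \<in> lang_list V (concat \<Pi>s)"
      by (auto simp: lang_list_append conc_def)
    with Cons have "u \<in> lang V a" "v \<in> lang V (Star a)" by auto
    then obtain ws where "ws \<in> lists (lang V a)" "v = concat ws" by auto
    with w \<open>u \<in> lang V a\<close> show "w \<in> lang V (Star a)"
      by (auto intro!: image_eqI[where x = "u # ws"])
  qed
qed

definition valid :: "(nat \<Rightarrow> 'a list set) \<Rightarrow> sequent \<Rightarrow> bool" where
  "valid V s \<longleftrightarrow> lang_list V (fst s) \<subseteq> lang V (snd s)"

text \<open>Concatenation is monotone, so a block of the antecedent may be replaced by any language
  containing its own. The left rules for divisions and meets are instances.\<close>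

lemma valid_cut:
  "lang_list V \<Pi> \<subseteq> A \<Longrightarrow> conc (lang_list V \<Gamma>) (conc A (lang_list V \<Delta>)) \<subseteq> C
    \<Longrightarrow> lang_list V (\<Gamma> @ \<Pi> @ \<Delta>) \<subseteq> C"
  unfolding lang_list_append by (meson conc_mono order_refl order_trans)

lemma valid_MALC:
  assumes "(P, \<Theta> \<turnstile> \<phi>) \<in> MALC" "\<forall>p\<in>P. valid V p"
  shows "valid V (\<Theta> \<turnstile> \<phi>)"
  using assms(1) unfolding MALC_def
proof
  assume "(P, \<Theta> \<turnstile> \<phi>) \<in> MALC_without_join"
  then show ?thesis
  proof cases
    case (ldiv_L \<Pi> \<alpha> \<Gamma> \<beta> \<Delta>)
    \<comment> \<open>Residuation: the block consisting of \<Pi> and the division lies in the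
      language of \<beta>, which can therefore take its place.\<close>
    have "lang_list V (\<Pi> @ [LDiv \<alpha> \<beta>]) \<subseteq> lang V \<beta>"
      using ldiv_L assms(2) by (auto simp: valid_def lang_list_append conc_def)
    then show ?thesis
      using valid_cut[of V "\<Pi> @ [LDiv \<alpha> \<beta>]" "lang V \<beta>" \<Gamma> \<Delta>] ldiv_L assms(2)
      by (simp add: valid_def lang_list_append conc_assoc)
  next
    case (rdiv_L \<Pi> \<alpha> \<Gamma> \<beta> \<Delta>)
    have "lang_list V ([RDiv \<beta> \<alpha>] @ \<Pi>) \<subseteq> lang V \<beta>"
      using rdiv_L assms(2) by (auto simp: valid_def lang_list_append conc_def)
    then show ?thesis
      using valid_cut[of V "[RDiv \<beta> \<alpha>] @ \<Pi>" "lang V \<beta>" \<Gamma> \<Delta>] rdiv_L assms(2)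
      by (simp add: valid_def lang_list_append conc_assoc)
  next
    case (meet_L1 \<Gamma> \<alpha>\<^sub>1 \<Delta> \<alpha>\<^sub>2)
    then show ?thesis
      using valid_cut[of V "[Meet \<alpha>\<^sub>1 \<alpha>\<^sub>2]" "lang V \<alpha>\<^sub>1" \<Gamma> \<Delta>] assms(2)
      by (simp add: valid_def lang_list_append)
  next
    case (meet_L2 \<Gamma> \<alpha>\<^sub>2 \<Delta> \<alpha>\<^sub>1)
    then show ?thesis
      using valid_cut[of V "[Meet \<alpha>\<^sub>1 \<alpha>\<^sub>2]" "lang V \<alpha>\<^sub>2" \<Gamma> \<Delta>] assms(2)
      by (simp add: valid_def lang_list_append)
  next
    case (zero_L \<Gamma> \<Delta>)
    then show ?thesis by (simp add: valid_def lang_list_append) (simp add: conc_def)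
  next
    case mult_L
    then show ?thesis
      using assms(2) by (simp add: valid_def lang_list_append conc_assoc)
  next
    case mult_R
    then show ?thesis
      using assms(2) by (simp add: valid_def lang_list_append conc_mono)
  next
    case (ldiv_R \<alpha> \<beta>)
    then show ?thesis
      using assms(2) by (auto simp: valid_def conc_def)
  next
    case (rdiv_R \<alpha> \<beta>)
    then show ?thesis
      using assms(2) by (auto simp: valid_def lang_list_append conc_def)
  qed (use assms(2) in \<open>simp_all add: valid_def lang_list_append\<close>)
next
  assume "(P, \<Theta> \<turnstile> \<phi>) \<in> join_rules"
  then show ?thesis
  proof cases
    case (join_L \<Gamma> \<alpha>\<^sub>1 \<Delta> \<alpha>\<^sub>2)
    have "conc A (conc (B \<union> B') C) = conc A (conc B C) \<union> conc A (conc B' C)" for A B B' C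
      :: "'a list set"
      by (auto simp: conc_def)
    with join_L show ?thesis
      using assms(2) by (simp add: valid_def lang_list_append)
  qed (use assms(2) in \<open>auto simp: valid_def\<close>)
qed

lemma valid_omega_rules:
  assumes "(P, \<Theta> \<turnstile> \<phi>) \<in> omega_rules" "\<forall>p\<in>P. valid V p"
  shows "valid V (\<Theta> \<turnstile> \<phi>)"
  using assms(1)
proof cases
  case (star_L_omega \<Gamma> \<alpha> \<Delta>)
  have "u @ concat ws @ v \<in> lang V \<phi>"
    if "u \<in> lang_list V \<Gamma>" "ws \<in> lists (lang V \<alpha>)" "v \<in> lang_list V \<Delta>" for u ws v
  proof -
    have "u @ concat ws @ v \<in> lang_list V (\<Gamma> @ replicate (length ws) \<alpha> @ \<Delta>)"
      unfolding lang_list_append using that by (intro concI concat_in_lang_list_replicate) auto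
    moreover have "valid V (\<Gamma> @ replicate (length ws) \<alpha> @ \<Delta> \<turnstile> \<phi>)"
      using star_L_omega assms(2) by blast
    ultimately show ?thesis by (auto simp: valid_def)
  qed
  with star_L_omega show ?thesis
    by (auto simp: valid_def lang_list_append conc_def)
next
  case (star_R \<alpha> \<Pi>s)
  then show ?thesis
    using assms(2) lang_list_concat_subset[of \<Pi>s V \<alpha>] by (auto simp: valid_def)
qed

theorem ACT_omega_sound: "s \<in> derivable ACT_omega_calculus \<Longrightarrow> valid V s"
proof (induction rule: derivable.induct)
  case (infer P s)
  then show ?case
    unfolding ACT_omega_calculus_def
    by (cases s) (blast dest: valid_MALC valid_omega_rules)
qed

section \<open>Derivations in action logic\<close>

abbreviation provable :: "sequent \<Rightarrow> bool" where
  "provable s \<equiv> s \<in> derivable ACT_without_join"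

lemma provable_MALC:
  "(P, s) \<in> MALC_without_join \<Longrightarrow> (\<And>p. p \<in> P \<Longrightarrow> provable p) \<Longrightarrow> provable s"
  by (rule derivable.infer[of P s]) (simp_all add: ACT_without_join_def)

lemma provable_action:
  "(P, s) \<in> action_rules \<Longrightarrow> (\<And>p. p \<in> P \<Longrightarrow> provable p) \<Longrightarrow> provable s"
  by (rule derivable.infer[of P s]) (simp_all add: ACT_without_join_def)

lemma provable_ax: "provable ([\<alpha>] \<turnstile> \<alpha>)"
  by (rule provable_MALC[OF MALC_without_join.ax]) auto

lemma provable_ldiv_L:
  "provable (\<Pi> \<turnstile> \<alpha>) \<Longrightarrow> provable (\<Gamma> @ [\<beta>] @ \<Delta> \<turnstile> \<gamma>)
    \<Longrightarrow> provable (\<Gamma> @ \<Pi> @ [LDiv \<alpha> \<beta>] @ \<Delta> \<turnstile> \<gamma>)"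
  by (rule provable_MALC[OF MALC_without_join.ldiv_L]) auto

lemma provable_rdiv_L:
  "provable (\<Pi> \<turnstile> \<alpha>) \<Longrightarrow> provable (\<Gamma> @ [\<beta>] @ \<Delta> \<turnstile> \<gamma>)
    \<Longrightarrow> provable (\<Gamma> @ [RDiv \<beta> \<alpha>] @ \<Pi> @ \<Delta> \<turnstile> \<gamma>)"
  by (rule provable_MALC[OF MALC_without_join.rdiv_L]) auto

lemma provable_ldiv_R: "provable (\<alpha> # \<Pi> \<turnstile> \<beta>) \<Longrightarrow> provable (\<Pi> \<turnstile> LDiv \<alpha> \<beta>)"
  by (rule provable_MALC[OF MALC_without_join.ldiv_R]) auto

lemma provable_rdiv_R: "provable (\<Pi> @ [\<alpha>] \<turnstile> \<beta>) \<Longrightarrow> provable (\<Pi> \<turnstile> RDiv \<beta> \<alpha>)"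
  by (rule provable_MALC[OF MALC_without_join.rdiv_R]) auto

lemma provable_mult_L:
  "provable (\<Gamma> @ [\<alpha>, \<beta>] @ \<Delta> \<turnstile> \<gamma>) \<Longrightarrow> provable (\<Gamma> @ [Mult \<alpha> \<beta>] @ \<Delta> \<turnstile> \<gamma>)"
  by (rule provable_MALC[OF MALC_without_join.mult_L]) auto

lemma provable_mult_R:
  "provable (\<Gamma> \<turnstile> \<alpha>) \<Longrightarrow> provable (\<Delta> \<turnstile> \<beta>) \<Longrightarrow> provable (\<Gamma> @ \<Delta> \<turnstile> Mult \<alpha> \<beta>)"
  by (rule provable_MALC[OF MALC_without_join.mult_R]) auto

lemma provable_meet_L1:
  "provable (\<Gamma> @ [\<alpha>\<^sub>1] @ \<Delta> \<turnstile> \<gamma>) \<Longrightarrow> provable (\<Gamma> @ [Meet \<alpha>\<^sub>1 \<alpha>\<^sub>2] @ \<Delta> \<turnstile> \<gamma>)"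
  by (rule provable_MALC[OF MALC_without_join.meet_L1]) auto

lemma provable_meet_L2:
  "provable (\<Gamma> @ [\<alpha>\<^sub>2] @ \<Delta> \<turnstile> \<gamma>) \<Longrightarrow> provable (\<Gamma> @ [Meet \<alpha>\<^sub>1 \<alpha>\<^sub>2] @ \<Delta> \<turnstile> \<gamma>)"
  by (rule provable_MALC[OF MALC_without_join.meet_L2]) auto

lemma provable_meet_R:
  "provable (\<Pi> \<turnstile> \<alpha>\<^sub>1) \<Longrightarrow> provable (\<Pi> \<turnstile> \<alpha>\<^sub>2) \<Longrightarrow> provable (\<Pi> \<turnstile> Meet \<alpha>\<^sub>1 \<alpha>\<^sub>2)"
  by (rule provable_MALC[OF MALC_without_join.meet_R]) auto

lemma provable_star_ind:
  "provable ([] \<turnstile> \<beta>) \<Longrightarrow> provable ([\<alpha>, \<beta>] \<turnstile> \<beta>) \<Longrightarrow> provable ([Star \<alpha>] \<turnstile> \<beta>)"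
  by (rule provable_action[OF action_rules.star_ind]) auto

lemma provable_cut:
  "provable (\<Pi> \<turnstile> \<alpha>) \<Longrightarrow> provable (\<Gamma> @ [\<alpha>] @ \<Delta> \<turnstile> \<gamma>) \<Longrightarrow> provable (\<Gamma> @ \<Pi> @ \<Delta> \<turnstile> \<gamma>)"
  by (rule provable_action[OF action_rules.cut]) auto

lemma provable_star_nil: "provable ([] \<turnstile> Star \<alpha>)"
  by (rule provable_action[OF action_rules.star_nil]) auto

lemma provable_star_cons:
  "provable (\<Pi> \<turnstile> \<alpha>) \<Longrightarrow> provable (\<Delta> \<turnstile> Star \<alpha>) \<Longrightarrow> provable (\<Pi> @ \<Delta> \<turnstile> Star \<alpha>)"
  by (rule provable_action[OF action_rules.star_cons]) auto

section \<open>Derived rules for stars, iterated divisions and finite meets\<close>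

lemma provable_star_replicate: "provable (replicate n \<alpha> \<turnstile> Star \<alpha>)"
proof (induction n)
  case (Suc n)
  then show ?case
    using provable_star_cons[OF provable_ax] by force
qed (simp add: provable_star_nil)

text \<open>\<open>fold\<close> makes the first formula of \<Gamma> the innermost divisor, so the
  formulae leave the antecedent one by one from its left end.\<close>

lemma provable_ldivs_R: "provable (\<Gamma> @ \<Pi> \<turnstile> \<gamma>) \<Longrightarrow> provable (\<Pi> \<turnstile> fold LDiv \<Gamma> \<gamma>)"
proof (induction \<Gamma> arbitrary: \<gamma>)
  case (Cons \<alpha> \<Gamma>)
  then show ?case
    using provable_ldiv_R by fastforce
qed simp

lemma provable_ldivs_L: "provable (\<Gamma> @ [fold LDiv \<Gamma> \<gamma>] \<turnstile> \<gamma>)"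
proof (induction \<Gamma> arbitrary: \<gamma>)
  case (Cons \<alpha> \<Gamma>)
  have "provable ([\<alpha>, LDiv \<alpha> \<gamma>] \<turnstile> \<gamma>)"
    using provable_ldiv_L[OF provable_ax, of "[]" \<gamma> "[]" \<gamma> \<alpha>] provable_ax by simp
  with Cons[of "LDiv \<alpha> \<gamma>"] show ?case
    using provable_cut[of "\<Gamma> @ [fold LDiv (\<alpha> # \<Gamma>) \<gamma>]" "LDiv \<alpha> \<gamma>" "[\<alpha>]" "[]" \<gamma>] by simp
qed (simp add: provable_ax)

text \<open>The induction rule for the star only applies to an antecedent consisting of a single starred
  formula, so the context is moved into the succedent, and \<open>Star \<alpha>\<close> itself is added to the
  induction formula in order to turn induction into case distinction.\<close>

lemma provable_star_unfold:
  assumes "provable (\<Gamma> @ [\<delta>] \<turnstile> \<gamma>)" "provable (\<Gamma> @ [\<alpha>, Star \<alpha>, \<delta>] \<turnstile> \<gamma>)"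
  shows "provable (\<Gamma> @ [Star \<alpha>, \<delta>] \<turnstile> \<gamma>)"
proof -
  define \<beta> where "\<beta> = RDiv (fold LDiv \<Gamma> \<gamma>) \<delta>"
  have nil: "provable ([] \<turnstile> \<beta>)"
    unfolding \<beta>_def using assms(1) by (simp add: provable_rdiv_R provable_ldivs_R)
  have cons: "provable ([\<alpha>, Star \<alpha>] \<turnstile> \<beta>)"
    unfolding \<beta>_def using assms(2) by (simp add: provable_rdiv_R provable_ldivs_R)
  have "provable ([\<alpha>, Star \<alpha>] \<turnstile> Meet (Star \<alpha>) \<beta>)"
    using provable_star_cons[OF provable_ax provable_ax] cons by (auto intro: provable_meet_R)
  then have "provable ([\<alpha>, Meet (Star \<alpha>) \<beta>] \<turnstile> Meet (Star \<alpha>) \<beta>)"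
    using provable_meet_L1[of "[\<alpha>]" "Star \<alpha>" "[]"] by simp
  then have "provable ([Star \<alpha>] \<turnstile> Meet (Star \<alpha>) \<beta>)"
    by (auto intro: provable_star_ind provable_meet_R provable_star_nil nil)
  moreover have "provable ([Meet (Star \<alpha>) \<beta>] \<turnstile> \<beta>)"
    using provable_meet_L2[of "[]" \<beta> "[]"] provable_ax by simp
  ultimately have star: "provable ([Star \<alpha>] \<turnstile> \<beta>)"
    using provable_cut[of "[Star \<alpha>]" _ "[]" "[]"] by force
  have "provable (\<Gamma> @ [\<beta>, \<delta>] \<turnstile> \<gamma>)"
    unfolding \<beta>_def
    using provable_rdiv_L[OF provable_ax, of \<Gamma> "fold LDiv \<Gamma> \<gamma>" "[]" \<gamma> \<delta>] provable_ldivs_L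
    by simp
  with star show ?thesis
    using provable_cut[of "[Star \<alpha>]" \<beta> \<Gamma> "[\<delta>]" \<gamma>] by simp
qed

text \<open>The last meetand is a formula that every sequence of formulae derives, so that empty meets
  are valid in all language models.\<close>

definition meets :: "form list \<Rightarrow> form" where
  "meets \<alpha>s = foldr Meet \<alpha>s (LDiv Zero Zero)"

lemma provable_meets_L:
  "\<alpha> \<in> set \<alpha>s \<Longrightarrow> provable (\<Gamma> @ [\<alpha>] @ \<Delta> \<turnstile> \<gamma>) \<Longrightarrow> provable (\<Gamma> @ [meets \<alpha>s] @ \<Delta> \<turnstile> \<gamma>)"
proof (induction \<alpha>s)
  case (Cons \<beta> \<alpha>s)
  then show ?case
    using provable_meet_L1[of \<Gamma> \<alpha> \<Delta> \<gamma>] provable_meet_L2[of \<Gamma> "meets \<alpha>s" \<Delta> \<gamma>]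
    by (auto simp: meets_def)
qed simp

text \<open>The basic simulation move: the meet appended at the right end offers many conditionals,
  and one whose hypothesis is derived by the whole preceding antecedent is selected.\<close>

lemma provable_meets_ldiv:
  assumes "LDiv \<alpha> \<beta> \<in> set \<alpha>s" "provable (\<Pi> \<turnstile> \<alpha>)"
  shows "provable (\<Pi> @ [meets \<alpha>s] \<turnstile> \<beta>)"
proof -
  have "provable (\<Pi> @ [LDiv \<alpha> \<beta>] \<turnstile> \<beta>)"
    using provable_ldiv_L[OF assms(2), of "[]" \<beta> "[]"] provable_ax by simp
  then show ?thesis
    using provable_meets_L[OF assms(1), of \<Pi> "[]"] by simp
qed

lemma lang_meets: "w \<in> lang V (meets \<alpha>s) \<longleftrightarrow> (\<forall>\<alpha>\<in>set \<alpha>s. w \<in> lang V \<alpha>)"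
  by (induction \<alpha>s) (auto simp: meets_def)

lemma join_free_meets: "join_free_form (meets \<alpha>s) \<longleftrightarrow> (\<forall>\<alpha>\<in>set \<alpha>s. join_free_form \<alpha>)"
  by (induction \<alpha>s) (auto simp: meets_def)


section \<open>Counter machines\<close>

datatype src = Clear | Copy nat | Incr nat | Decr nat

primrec src_val :: "(nat \<Rightarrow> nat) \<Rightarrow> src \<Rightarrow> nat" where
  "src_val R Clear = 0"
| "src_val R (Copy s) = R s"
| "src_val R (Incr s) = Suc (R s)"
| "src_val R (Decr s) = R s - 1"

primrec src_within :: "nat \<Rightarrow> src \<Rightarrow> bool" where
  "src_within k Clear \<longleftrightarrow> True"
| "src_within k (Copy s) \<longleftrightarrow> s < k"
| "src_within k (Incr s) \<longleftrightarrow> s < k"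
| "src_within k (Decr s) \<longleftrightarrow> s < k"

text \<open>\<open>Assign\<close> updates all registers simultaneously from their old values, just
  as one appended formula has to re-establish the information on every register.\<close>

datatype instr = Assign "nat \<Rightarrow> src" nat | Test nat nat nat

type_synonym config = "nat \<times> (nat \<Rightarrow> nat)"

primrec exec_instr :: "instr \<Rightarrow> (nat \<Rightarrow> nat) \<Rightarrow> config" where
  "exec_instr (Assign f l) R = (l, \<lambda>r. src_val R (f r))"
| "exec_instr (Test r l m) R = (if R r = 0 then l else m, R)"

primrec instr_within :: "nat \<Rightarrow> instr \<Rightarrow> bool" where
  "instr_within k (Assign f l) \<longleftrightarrow> (\<forall>r<k. src_within k (f r))"
| "instr_within k (Test r l m) \<longleftrightarrow> r < k"

text \<open>Counters outside the program are absorbing. Two of them serve as outcomes: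
  \<open>length P\<close> for being trapped and \<open>Suc (length P)\<close> for escaping.\<close>

definition step :: "instr list \<Rightarrow> config \<Rightarrow> config" where
  "step P c = (if fst c < length P then exec_instr (P ! fst c) (snd c) else c)"

abbreviation incr_reg :: "nat \<Rightarrow> nat \<Rightarrow> src" where
  "incr_reg r \<equiv> Copy(r := Incr r)"

section \<open>Computations as sequents\<close>

text \<open>The configuration with program counter \<open>p\<close> and registers \<open>R\<close> is represented by an antecedent
  \<open>\<Gamma>\<close> that derives \<open>state p\<close> and such that \<open>replicate i unit @ \<Gamma>\<close> derives \<open>below r (i < R r)\<close> for
  all registers \<open>r\<close> and all \<open>i\<close>. A computation step appends one formula at the right end. The
  formula \<open>at p\<close> makes the program counter available behind any number of units.\<close>

definition unit :: form where "unit = Var 0"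
definition good :: form where "good = Var 1"
text \<open>With \<open>unit\<close> and \<open>good\<close> on indices 0 and 1, the remaining
  variables are kept apart by residues modulo 3: 2 for \<open>state\<close>, 0 and 1 for the two
  forms of \<open>below\<close>, shifted past the first two indices.\<close>

definition state :: "nat \<Rightarrow> form" where "state q = Var (3 * q + 2)"
definition below :: "nat \<Rightarrow> bool \<Rightarrow> form" where "below r b = Var (3 * r + (if b then 3 else 4))"
definition at :: "nat \<Rightarrow> form" where "at p = Mult (Star unit) (state p)"

lemma join_free_atoms [simp]: "join_free_form unit" "join_free_form good"
  "join_free_form (state q)" "join_free_form (below r b)" "join_free_form (at p)"
  by (simp_all add: unit_def good_def state_def below_def at_def)

text \<open>The number i of leading units is compared with a register. For \<open>Incr\<close> the
  comparison holds at 0, hence the rule from plain \<open>state p\<close>, and otherwise one unit is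
  split off; for \<open>Decr\<close> one unit is added, because \<open>i < R s - 1\<close> means
  \<open>Suc i < R s\<close>.\<close>

primrec src_rules :: "nat \<Rightarrow> nat \<Rightarrow> src \<Rightarrow> form list" where
  "src_rules p r Clear = [LDiv (at p) (below r False)]"
| "src_rules p r (Copy s) =
    map (\<lambda>b. LDiv (Meet (at p) (below s b)) (below r b)) [True, False]"
| "src_rules p r (Incr s) = LDiv (state p) (below r True) #
    map (\<lambda>b. LDiv (Meet (at p) (Mult unit (below s b))) (below r b)) [True, False]"
| "src_rules p r (Decr s) =
    map (\<lambda>b. LDiv (Meet (at p) (LDiv unit (below s b))) (below r b)) [True, False]"

text \<open>A zero test compares 0 with the register, so its rules use \<open>state p\<close>, which
  the model below interprets by histories without leading units. The number \<open>k\<close> bounds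
  the registers that are tracked.\<close>

primrec instr_rules :: "nat \<Rightarrow> nat \<Rightarrow> instr \<Rightarrow> form list" where
  "instr_rules k p (Assign f l) =
    LDiv (state p) (state l) # concat (map (\<lambda>r. src_rules p r (f r)) [0..<k])"
| "instr_rules k p (Test s l m) =
    LDiv (Meet (state p) (below s False)) (state l) #
    LDiv (Meet (state p) (below s True)) (state m) #
    concat (map (\<lambda>r. src_rules p r (Copy r)) [0..<k])"

definition start_form :: form where
  "start_form = meets [state 0, LDiv (Star unit) (below 0 False), LDiv (Star unit) (below 1 False)]"

text \<open>An input symbol acts like an increment instruction at counter 0 that stays at counter
  0.\<close>

definition input_form :: "nat \<Rightarrow> form" where
  "input_form r = meets (instr_rules 2 0 (Assign (incr_reg r) 0))"

text \<open>One formula serves for all steps, since the derived \<open>state\<close> selects the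
  instruction. The first meetand makes the trap counter \<open>length P\<close> an
  invariant.\<close>

definition step_form :: "nat \<Rightarrow> instr list \<Rightarrow> form" where
  "step_form k P = meets (LDiv (state (length P)) (state (length P)) #
     concat (map (\<lambda>p. instr_rules k p (P ! p)) [0..<length P]))"

text \<open>All counters up to the trap are accepted; the escape counter
  \<open>Suc (length P)\<close> is left out.\<close>

definition end_form :: "instr list \<Rightarrow> form" where
  "end_form P = meets (map (\<lambda>q. LDiv (state q) good) [0..<Suc (length P)])"

definition program_form :: "nat \<Rightarrow> instr list \<Rightarrow> form" where
  "program_form k P = Mult (Star (step_form k P)) (end_form P)"

definition run_sequent :: "form \<Rightarrow> nat \<Rightarrow> nat \<Rightarrow> sequent" where
  "run_sequent \<alpha> x y =
    start_form # replicate x (input_form 0) @ replicate y (input_form 1) @ [\<alpha>] \<turnstile> good"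

lemma join_free_src_rules: "\<alpha> \<in> set (src_rules p r e) \<Longrightarrow> join_free_form \<alpha>"
  by (cases e) auto

lemma join_free_instr_rules: "\<alpha> \<in> set (instr_rules k p i) \<Longrightarrow> join_free_form \<alpha>"
  by (cases i) (auto dest: join_free_src_rules simp del: src_rules.simps)

lemma join_free_run_sequent: "join_free (run_sequent (program_form k P) x y)"
  by (auto simp: join_free_def run_sequent_def program_form_def start_form_def input_form_def
      step_form_def end_form_def join_free_meets dest: join_free_instr_rules
      simp del: instr_rules.simps)

subsection \<open>Trapped computations\<close>

definition represents :: "nat \<Rightarrow> form list \<Rightarrow> config \<Rightarrow> bool" where
  "represents k \<Gamma> c \<longleftrightarrow> provable (\<Gamma> \<turnstile> state (fst c)) \<and>
    (\<forall>r<k. \<forall>i. provable (replicate i unit @ \<Gamma> \<turnstile> below r (i < snd c r)))"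

lemma provable_at: "provable (\<Gamma> \<turnstile> state p) \<Longrightarrow> provable (replicate i unit @ \<Gamma> \<turnstile> at p)"
  unfolding at_def by (rule provable_mult_R[OF provable_star_replicate])

lemma provable_src_rules:
  assumes rules: "set (src_rules p r e) \<subseteq> set \<alpha>s"
    and st: "provable (\<Gamma> \<turnstile> state p)"
    and e: "src_within k e"
    and below: "\<And>s i. s < k \<Longrightarrow> provable (replicate i unit @ \<Gamma> \<turnstile> below s (i < R s))"
  shows "provable (replicate i unit @ \<Gamma> @ [meets \<alpha>s] \<turnstile> below r (i < src_val R e))"
proof (cases e)
  case Clear
  then show ?thesis
    using rules provable_meets_ldiv[OF _ provable_at[OF st], of "below r False" \<alpha>s i] by auto
next
  case (Copy s)
  have "provable (replicate i unit @ \<Gamma> \<turnstile> Meet (at p) (below s (i < R s)))"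
    using Copy e by (intro provable_meet_R provable_at st below) simp
  from provable_meets_ldiv[OF _ this, of "below r (i < R s)"] show ?thesis
    using rules Copy by (cases "i < R s") auto
next
  case (Incr s)
  show ?thesis
  proof (cases i)
    case 0
    then show ?thesis
      using rules Incr provable_meets_ldiv[OF _ st, of "below r True"] by auto
  next
    case (Suc j)
    \<comment> \<open>One leading unit goes to the first factor of the product; the remaining
      \<open>j\<close> units compare \<open>j\<close> with \<open>R s\<close>.\<close>
    have "provable (replicate i unit @ \<Gamma> \<turnstile> Mult unit (below s (j < R s)))"
      using provable_mult_R[OF provable_ax below] Incr e Suc by fastforce
    then have "provable (replicate i unit @ \<Gamma> \<turnstile> Meet (at p) (Mult unit (below s (j < R s))))"
      by (intro provable_meet_R provable_at st)
    from provable_meets_ldiv[OF _ this, of "below r (j < R s)"] show ?thesis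
      using rules Incr Suc by (cases "j < R s") auto
  qed
next
  case (Decr s)
  \<comment> \<open>The unit brought in by the right rule for division raises the comparison from i
    to \<open>Suc i\<close>.\<close>
  have "provable (replicate i unit @ \<Gamma> \<turnstile> LDiv unit (below s (Suc i < R s)))"
    using below[of s "Suc i"] Decr e by (intro provable_ldiv_R) simp
  then have "provable (replicate i unit @ \<Gamma> \<turnstile> Meet (at p) (LDiv unit (below s (Suc i < R s))))"
    by (intro provable_meet_R provable_at st)
  from provable_meets_ldiv[OF _ this, of "below r (Suc i < R s)"] show ?thesis
    using rules Decr by (cases "Suc i < R s") (auto simp: less_diff_conv)
qed

text \<open>The bounds \<open>k\<close> and \<open>k'\<close> may differ because the initial
  instruction passes from two known registers to all tracked ones: a cleared register draws on no
  earlier information.\<close>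

lemma represents_exec_instr:
  assumes \<Gamma>: "represents k \<Gamma> (p, R)"
    and rules: "set (instr_rules k' p i) \<subseteq> set \<alpha>s"
    and within: "case i of Assign f l \<Rightarrow> \<forall>r<k'. src_within k (f r) | Test r l m \<Rightarrow> r < k \<and> k' \<le> k"
  shows "represents k' (\<Gamma> @ [meets \<alpha>s]) (exec_instr i R)"
proof -
  have st: "provable (\<Gamma> \<turnstile> state p)"
    and below: "\<And>s i. s < k \<Longrightarrow> provable (replicate i unit @ \<Gamma> \<turnstile> below s (i < R s))"
    using \<Gamma> by (auto simp: represents_def)
  have src: "provable (replicate j unit @ \<Gamma> @ [meets \<alpha>s] \<turnstile> below r (j < src_val R e))"
    if "set (src_rules p r e) \<subseteq> set \<alpha>s" "src_within k e" for r e j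
    using provable_src_rules[OF that(1) st that(2) below] .
  show ?thesis
  proof (cases i)
    case (Assign f l)
    have "provable (\<Gamma> @ [meets \<alpha>s] \<turnstile> state l)"
      using rules Assign by (intro provable_meets_ldiv[OF _ st]) auto
    moreover have "provable (replicate j unit @ \<Gamma> @ [meets \<alpha>s] \<turnstile> below r (j < src_val R (f r)))"
      if "r < k'" for r j
    proof (rule src)
      have "set (src_rules p r (f r)) \<subseteq> set (instr_rules k' p i)"
        using that Assign by (fastforce simp del: src_rules.simps)
      with rules show "set (src_rules p r (f r)) \<subseteq> set \<alpha>s"
        by blast
      show "src_within k (f r)"
        using within Assign that by simp
    qed
    ultimately show ?thesis
      using Assign by (simp add: represents_def)
  next
    case (Test s l m)
    have "provable (\<Gamma> \<turnstile> Meet (state p) (below s (0 < R s)))"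
      using below[of s 0] within Test by (intro provable_meet_R st) simp
    from provable_meets_ldiv[OF _ this]
    have "provable (\<Gamma> @ [meets \<alpha>s] \<turnstile> state (if R s = 0 then l else m))"
      using rules Test by (cases "R s") auto
    moreover have "provable (replicate j unit @ \<Gamma> @ [meets \<alpha>s] \<turnstile> below r (j < R r))"
      if "r < k'" for r j
    proof -
      have "set (src_rules p r (Copy r)) \<subseteq> set (instr_rules k' p i)"
        using that Test by (fastforce simp del: src_rules.simps)
      with rules have "set (src_rules p r (Copy r)) \<subseteq> set \<alpha>s"
        by blast
      from src[OF this, of j] show ?thesis
        using within Test that by simp
    qed
    ultimately show ?thesis
      using Test by (simp add: represents_def)
  qed
qed

lemma represents_input:
  assumes "represents 2 \<Gamma> (0, R)" "r < 2"
  shows "represents 2 (\<Gamma> @ replicate n (input_form r)) (0, R(r := R r + n))"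
proof (induction n)
  case (Suc n)
  have "represents 2 (\<Delta> @ [input_form r]) (exec_instr (Assign (incr_reg r) 0) R')"
    if "represents 2 \<Delta> (0, R')" for \<Delta> R'
    unfolding input_form_def using assms(2) that
    by (intro represents_exec_instr[where k = 2 and p = 0]) auto
  from this[OF Suc] have "represents 2 ((\<Gamma> @ replicate n (input_form r)) @ [input_form r])
      (exec_instr (Assign (incr_reg r) 0) (R(r := R r + n)))" .
  moreover have "exec_instr (Assign (incr_reg r) 0) (R(r := R r + n)) = (0, R(r := R r + Suc n))"
    by auto
  ultimately show ?case
    by (metis append_assoc replicate_Suc replicate_append_same)
qed (use assms in simp)

lemma represents_start: "represents 2 [start_form] (0, \<lambda>_. 0)"
proof -
  have "provable ([] @ [start_form] @ [] \<turnstile> state 0)"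
    unfolding start_form_def by (rule provable_meets_L[of "state 0"]) (simp_all add: provable_ax)
  moreover have "provable (replicate i unit @ [start_form] \<turnstile> below r False)" if "r < 2" for r i
    unfolding start_form_def
    by (rule provable_meets_ldiv[of "Star unit"])
      (use that in \<open>auto simp: less_2_cases_iff provable_star_replicate\<close>)
  ultimately show ?thesis
    by (simp add: represents_def)
qed

text \<open>The first instruction clears all but the two input registers, which are the only ones that
  the input part of the antecedent provides.\<close>

definition init_instr :: instr where
  "init_instr = Assign (\<lambda>r. if r < 2 then Copy r else Clear) 1"

definition initial :: "nat \<Rightarrow> nat \<Rightarrow> config" where
  "initial x y = (0, (\<lambda>_. 0)(0 := x, 1 := y))"

theorem run_sequent_provable:
  assumes P: "P \<noteq> []" "P ! 0 = init_instr" "\<forall>i\<in>set P. instr_within k i"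
    and trap: "fst ((step P ^^ n) (initial x y)) = length P"
    and before: "\<And>m. m < n \<Longrightarrow> fst ((step P ^^ m) (initial x y)) < length P"
  shows "run_sequent (program_form k P) x y \<in> ACT_meet"
proof -
  define \<Gamma> where "\<Gamma> m = start_form # replicate x (input_form 0) @ replicate y (input_form 1)
    @ replicate m (step_form k P)" for m
  let ?c = "\<lambda>m. (step P ^^ m) (initial x y)"
  have rules: "set (instr_rules k p (P ! p)) \<subseteq> set (LDiv (state (length P)) (state (length P)) #
     concat (map (\<lambda>p. instr_rules k p (P ! p)) [0..<length P]))" if "p < length P" for p
    using that by (auto simp del: instr_rules.simps)
  have \<Gamma>_Suc: "\<Gamma> (Suc m) = \<Gamma> m @ [step_form k P]" for m
    by (simp add: \<Gamma>_def replicate_append_same)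
  have \<Gamma>_0: "represents 2 (\<Gamma> 0) (?c 0)"
  proof -
    have "represents 2 ([start_form] @ replicate x (input_form 0)) (0, (\<lambda>_. 0)(0 := x))"
      using represents_input[OF represents_start, of 0 x] by simp
    from represents_input[OF this, of 1 y]
    have "represents 2 (([start_form] @ replicate x (input_form 0)) @ replicate y (input_form 1))
        (0, (\<lambda>_. 0)(0 := x, 1 := y))"
      by simp
    then show ?thesis
      by (simp add: \<Gamma>_def initial_def)
  qed
  \<comment> \<open>From the first step on all \<open>k\<close> registers are represented; before it
    only the two input registers are.\<close>
  have rep: "represents k (\<Gamma> (Suc m)) (?c (Suc m))" if "m < n" for m
    using that
  proof (induction m)
    case 0
    have "represents k (\<Gamma> 0 @ [step_form k P]) (exec_instr (P ! 0) (snd (?c 0)))"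
      unfolding step_form_def using \<Gamma>_0 P
      by (intro represents_exec_instr[OF _ rules])
        (auto simp: initial_def init_instr_def \<Gamma>_def)
    then show ?case
      using before[OF 0] by (simp add: \<Gamma>_Suc step_def initial_def P)
  next
    case (Suc m)
    let ?i = "P ! fst (?c (Suc m))"
    have lt: "fst (?c (Suc m)) < length P"
      using before[OF Suc.prems] .
    then have "instr_within k ?i"
      using P(3) by auto
    then have "represents k (\<Gamma> (Suc m) @ [step_form k P]) (exec_instr ?i (snd (?c (Suc m))))"
      unfolding step_form_def using Suc lt
      by (intro represents_exec_instr[OF _ rules])
        (auto split: instr.splits simp del: funpow.simps)
    moreover have "?c (Suc (Suc m)) = exec_instr ?i (snd (?c (Suc m)))"
      using lt by (simp add: step_def[of P "step P ((step P ^^ m) (initial x y))"])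
    ultimately show ?case
      by (simp only: \<Gamma>_Suc[of "Suc m"])
  qed
  have st: "provable (\<Gamma> m \<turnstile> state (fst (?c m)))" if "m \<le> n" for m
    using \<Gamma>_0 rep[of "m - 1"] that by (cases m) (auto simp: represents_def simp del: funpow.simps)
  have end_rule: "LDiv (state q) good \<in> set (map (\<lambda>q. LDiv (state q) good) [0..<Suc (length P)])"
    if "q \<le> length P" for q
    using that by (auto intro!: image_eqI[where x = q] simp del: upt_Suc)
  have good: "provable (\<Gamma> m @ [end_form P] \<turnstile> good)" if "m \<le> n" for m
    unfolding end_form_def
    using that before[of m] trap by (intro provable_meets_ldiv[OF end_rule st]) (cases "m = n", auto)
  \<comment> \<open>Downward induction on the number m of explicit steps: at m = n the star is
    absorbed by the invariant, and below n unfolding either ends the run, with the counter still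
    accepted by \<open>end_form\<close>, or adds one more step.\<close>
  have "provable (\<Gamma> m @ [Star (step_form k P), end_form P] \<turnstile> good)" if "m \<le> n" for m
    using that
  proof (induction m rule: inc_induct)
    case base
    let ?q = "state (length P)"
    have "provable ([?q] @ [step_form k P] \<turnstile> ?q)"
      unfolding step_form_def by (intro provable_meets_ldiv[OF _ provable_ax]) simp
    \<comment> \<open>Star induction with the formula \<open>LDiv ?q ?q\<close>, where
      \<open>?q\<close> is the trap state: every further step formula maps \<open>?q\<close> to
      itself.\<close>
    then have "provable ([step_form k P, LDiv ?q ?q] \<turnstile> LDiv ?q ?q)"
      using provable_ldiv_L[of "[?q, step_form k P]" ?q "[]" ?q "[]"] provable_ax
      by (intro provable_ldiv_R) simp
    then have star: "provable ([Star (step_form k P)] \<turnstile> LDiv ?q ?q)"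
      by (rule provable_star_ind[OF provable_ldiv_R[OF provable_ax]])
    have "provable ([?q] @ [end_form P] \<turnstile> good)"
      unfolding end_form_def by (intro provable_meets_ldiv[OF end_rule provable_ax]) simp
    from provable_ldiv_L[OF st[OF order_refl, unfolded trap], of "[]" ?q "[end_form P]"] this
    have "provable (\<Gamma> n @ [LDiv ?q ?q, end_form P] \<turnstile> good)"
      by simp
    then show ?case
      using provable_cut[OF star, of "\<Gamma> n" "[end_form P]"] by simp
  next
    case (step m)
    show ?case
      using step good[of m] by (intro provable_star_unfold) (simp_all add: \<Gamma>_Suc)
  qed
  from provable_mult_L[of "\<Gamma> 0", of _ _ "[]"] this[of 0]
  have "provable (\<Gamma> 0 @ [program_form k P] \<turnstile> good)"
    by (simp add: program_form_def)
  then show ?thesis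
    by (simp add: ACT_meet_def join_free_run_sequent) (simp add: run_sequent_def \<Gamma>_def)
qed

subsection \<open>Escaping computations\<close>

datatype letter = LUnit | LStart | LInput nat | LStep | LEnd

text \<open>The words after \<open>LStart\<close> are computation histories; letters in odd places do nothing.\<close>

primrec act :: "instr list \<Rightarrow> letter \<Rightarrow> config \<Rightarrow> config" where
  "act P LUnit c = c"
| "act P LStart c = c"
| "act P (LInput r) c = (fst c, (snd c)(r := Suc (snd c r)))"
| "act P LStep c = step P c"
| "act P LEnd c = c"

definition reached :: "instr list \<Rightarrow> letter list \<Rightarrow> config" where
  "reached P w = fold (act P) w (0, \<lambda>_. 0)"

lemma reached_snoc [simp]: "reached P (w @ [a]) = act P a (reached P w)"
  by (simp add: reached_def)

text \<open>The first \<open>LStart\<close> separates the leading units from the computation, so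
  both parts can be read off from the word.\<close>

definition history :: "nat \<Rightarrow> letter list \<Rightarrow> letter list" where
  "history i w = replicate i LUnit @ LStart # w"

lemma history_append [simp]: "history i w @ v = history i (w @ v)"
  by (simp add: history_def)

lemma append_history [simp]: "replicate j LUnit @ history i w = history (j + i) w"
  by (simp add: history_def replicate_add)

lemma Cons_history [simp]: "LUnit # history i w = history (Suc i) w"
  by (simp add: history_def)

lemma history_eq_iff [simp]: "history i w = history j v \<longleftrightarrow> i = j \<and> w = v"
  unfolding history_def
proof (induction i arbitrary: j)
  case 0
  then show ?case by (cases j) auto
next
  case (Suc i)
  then show ?case by (cases j) auto
qed

text \<open>The valuation as a relation between variable indices and words. Apart from
  \<open>unit\<close>, each variable holds of the histories for which its informal reading is true;
  for \<open>good\<close> this means that the counter is not the escape counter when the final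
  \<open>LEnd\<close> is read.\<close>

inductive_set model :: "instr list \<Rightarrow> (nat \<times> letter list) set" for P where
  unit: "(0, [LUnit]) \<in> model P"
| good: "fst (reached P w) \<noteq> Suc (length P) \<Longrightarrow> (1, history 0 (w @ [LEnd])) \<in> model P"
| state: "(3 * fst (reached P w) + 2, history 0 w) \<in> model P"
| below: "(3 * r + (if i < snd (reached P w) r then 3 else 4), history i w) \<in> model P"

abbreviation lang_model :: "instr list \<Rightarrow> form \<Rightarrow> letter list set" where
  "lang_model P \<equiv> lang (\<lambda>n. {w. (n, w) \<in> model P})"

lemma lang_unit: "lang_model P unit = {[LUnit]}"
  by (auto simp: unit_def model.simps)

lemma lang_good:
  "lang_model P good = {history 0 (w @ [LEnd]) | w. fst (reached P w) \<noteq> Suc (length P)}"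
  by (auto simp: good_def model.simps)

lemma lang_state: "lang_model P (state q) = {history 0 w | w. fst (reached P w) = q}"
proof -
  have "3 * q + 2 \<noteq> 3 * r + (if b then 3 else 4)" for r b
    by (cases b) presburger+
  then have "(3 * q + 2, w) \<in> model P \<longleftrightarrow> (\<exists>v. w = history 0 v \<and> fst (reached P v) = q)" for w
    unfolding model.simps[of "3 * q + 2"] by auto
  then show ?thesis
    by (auto simp: state_def simp del: add_2_eq_Suc')
qed

lemma lang_below: "lang_model P (below r b) = {history i w | i w. (i < snd (reached P w) r) = b}"
proof -
  have "3 * r + (if b then 3 else 4) \<noteq> 3 * q + (2::nat)" for q
    by (cases b) presburger+
  moreover have "3 * r + (if b then 3 else 4) = 3 * r' + (if b' then 3 else (4::nat)) \<longleftrightarrow> r = r' \<and> b = b'"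
    for r' b'
    by (cases b; cases b'; presburger)
  ultimately have "(3 * r + (if b then 3 else 4), w) \<in> model P
      \<longleftrightarrow> (\<exists>i v. w = history i v \<and> (i < snd (reached P v) r) = b)" for w
    unfolding model.simps[of "3 * r + (if b then 3 else 4)"] by auto
  then show ?thesis
    by (simp add: below_def)
qed

lemma lang_units: "lang_model P (Star unit) = {replicate i LUnit | i. True}"
proof -
  have "us \<in> lists {[LUnit]} \<Longrightarrow> concat us = replicate (length us) LUnit" for us
    by (induction us) auto
  then have "lang_model P (Star unit) \<subseteq> {replicate i LUnit | i. True}"
    by (auto simp: lang_unit)
  moreover have "replicate i LUnit = concat (replicate i [LUnit])" for i
    by (induction i) auto
  then have "replicate i LUnit \<in> lang_model P (Star unit)" for i
    by (auto simp: lang_unit intro!: image_eqI[where x = "replicate i [LUnit]"])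
  ultimately show ?thesis
    by auto
qed

lemma lang_at: "lang_model P (at p) = {history i w | i w. fst (reached P w) = p}"
  unfolding at_def lang.simps(4) lang_units lang_state conc_def
  by (auto, metis add_0_right append_history)

text \<open>A one-letter word lies in a division iff appending the letter leads from the divisor to
  the other language, so only a single step of the machine has to be inspected.\<close>

lemma src_rules_sound:
  assumes "\<And>w. fst (reached P w) = p
      \<Longrightarrow> snd (act P a (reached P w)) r = src_val (snd (reached P w)) e"
    and "\<alpha> \<in> set (src_rules p r e)"
  shows "[a] \<in> lang_model P \<alpha>"
proof (cases e)
  case Clear
  then show ?thesis
    using assms by (auto simp: lang_at lang_below)
next
  case (Copy s)
  then show ?thesis
    using assms by (auto simp: lang_at lang_below)
next
  case (Incr s)
  then show ?thesis
    using assms by (auto simp: lang_at lang_below lang_state lang_unit conc_def)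
next
  case (Decr s)
  then show ?thesis
    using assms by (auto simp: lang_at lang_below lang_unit)
qed

text \<open>Every rule is conditional on counter \<open>p\<close>, so at other counters it holds
  vacuously. This is why the instructions of a whole program can be conjoined in a single
  formula.\<close>

lemma instr_rules_sound:
  assumes act: "\<And>w. fst (reached P w) = p \<Longrightarrow> act P a (reached P w) = exec_instr i (snd (reached P w))"
    and \<alpha>: "\<alpha> \<in> set (instr_rules k p i)"
  shows "[a] \<in> lang_model P \<alpha>"
proof (cases i)
  case (Assign f l)
  then consider "\<alpha> = LDiv (state p) (state l)" | r where "\<alpha> \<in> set (src_rules p r (f r))"
    using \<alpha> by auto
  then show ?thesis
  proof cases
    case 1
    then show ?thesis using act Assign by (auto simp: lang_state)
  next
    case 2
    show ?thesis by (rule src_rules_sound[OF _ 2]) (simp add: act Assign)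
  qed
next
  case (Test s l m)
  then consider "\<alpha> = LDiv (Meet (state p) (below s False)) (state l)"
    | "\<alpha> = LDiv (Meet (state p) (below s True)) (state m)"
    | r where "\<alpha> \<in> set (src_rules p r (Copy r))"
    using \<alpha> by (auto simp del: src_rules.simps)
  then show ?thesis
  proof cases
    case 3
    show ?thesis by (rule src_rules_sound[OF _ 3]) (simp add: act Test)
  qed (use act Test in \<open>auto simp: lang_state lang_below\<close>)
qed

theorem run_sequent_refutable:
  assumes escape: "fst ((step P ^^ n) (initial x y)) = Suc (length P)"
  shows "run_sequent (program_form k P) x y \<notin> ACT_omega_meet"
proof
  assume "run_sequent (program_form k P) x y \<in> ACT_omega_meet"
  then have valid: "valid (\<lambda>n. {w. (n, w) \<in> model P}) (run_sequent (program_form k P) x y)"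
    by (simp add: ACT_omega_meet_def ACT_omega_sound)
  \<comment> \<open>The letters of the actual run: between \<open>LStart\<close> and
    \<open>LEnd\<close> they form a word in the language of the antecedent, but at the escape
    counter it does not belong to \<open>good\<close>.\<close>
  let ?v = "replicate x (LInput 0) @ replicate y (LInput 1) @ replicate n LStep"
  have inputs: "fold (act P) (replicate j (LInput r)) (p, R) = (p, R(r := R r + j))" for r p R j
    by (induction j arbitrary: R) auto
  have steps: "fold (act P) (replicate j LStep) c = (step P ^^ j) c" for c j
    by (induction j arbitrary: c) (auto simp: funpow_swap1)
  have v: "reached P ?v = (step P ^^ n) (initial x y)"
    by (simp add: reached_def inputs steps initial_def del: fold_replicate One_nat_def)
  have replicate: "replicate j a \<in> lang_list (\<lambda>n. {w. (n, w) \<in> model P}) (replicate j \<alpha>)"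
    if "[a] \<in> lang_model P \<alpha>" for a j \<alpha>
  proof (induction j)
    case (Suc j)
    with that concI[of "[a]"] show ?case by simp
  qed simp
  have start: "[LStart] \<in> lang_model P start_form"
  proof -
    have "[LStart] = history 0 []"
      by (simp add: history_def)
    then show ?thesis
      by (auto simp: start_form_def lang_meets lang_state lang_units lang_below reached_def
          simp del: lang.simps(9))
  qed
  have input: "[LInput r] \<in> lang_model P (input_form r)" for r
    unfolding input_form_def lang_meets
    by (auto simp: fun_eq_iff prod_eq_iff intro!: instr_rules_sound simp del: instr_rules.simps)
  have "[LStep] \<in> lang_model P (step_form k P)"
    unfolding step_form_def lang_meets
    by (auto simp: lang_state step_def intro!: instr_rules_sound simp del: instr_rules.simps)
  then have steps: "replicate n LStep \<in> lang_model P (Star (step_form k P))"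
    by (auto intro!: image_eqI[where x = "replicate n [LStep]"])
  \<comment> \<open>The counters listed in \<open>end_form\<close> are at most
    \<open>length P\<close>, hence differ from the escape counter.\<close>
  have "[LEnd] \<in> lang_model P (end_form P)"
    by (auto simp: end_form_def lang_meets lang_state lang_good)
  with steps have "replicate n LStep @ [LEnd] \<in> lang_model P (program_form k P)"
    by (simp add: program_form_def concI del: lang.simps(9))
  then have "[LStart] @ replicate x (LInput 0) @ replicate y (LInput 1) @ replicate n LStep @ [LEnd]
      \<in> lang_list (\<lambda>n. {w. (n, w) \<in> model P}) (fst (run_sequent (program_form k P) x y))"
    unfolding run_sequent_def fst_conv lang_list.simps lang_list_append conc_Nil
    by (intro concI start replicate input)
  with valid have "history 0 (?v @ [LEnd]) \<in> lang_model P good"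
    by (auto simp: valid_def run_sequent_def history_def)
  then have "fst (reached P ?v) \<noteq> Suc (length P)"
    by (auto simp: lang_good)
  with v escape show False
    by simp
qed


section \<open>Compiling recursive functions to counter machines\<close>

datatype com = Skip | Set nat src | Seq com com | While nat com

inductive big_step :: "com \<Rightarrow> (nat \<Rightarrow> nat) \<Rightarrow> (nat \<Rightarrow> nat) \<Rightarrow> bool" where
  Skip: "big_step Skip R R"
| Set: "big_step (Set r e) R (R(r := src_val R e))"
| Seq: "big_step c R S \<Longrightarrow> big_step d S T \<Longrightarrow> big_step (Seq c d) R T"
| While_0: "R r = 0 \<Longrightarrow> big_step (While r c) R R"
| While: "R r \<noteq> 0 \<Longrightarrow> big_step c R S \<Longrightarrow> big_step (While r c) S T \<Longrightarrow> big_step (While r c) R T"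

lemma big_step_Set: "S = R(r := src_val R e) \<Longrightarrow> big_step (Set r e) R S"
  by (simp add: big_step.Set)

text \<open>The number \<open>a\<close> is the address of the first instruction. A loop has its test
  at \<open>a\<close> and is left for \<open>Suc n\<close>, just behind the jump back, which is the
  identity assignment at address \<open>n\<close>.\<close>

primrec code :: "nat \<Rightarrow> com \<Rightarrow> instr list" where
  "code a Skip = []"
| "code a (Set r e) = [Assign (Copy(r := e)) (Suc a)]"
| "code a (Seq c d) = code a c @ code (a + length (code a c)) d"
| "code a (While r c) = (let n = a + Suc (length (code (Suc a) c)) in
    Test r (Suc n) (Suc a) # code (Suc a) c @ [Assign Copy a])"

definition occurs :: "instr list \<Rightarrow> nat \<Rightarrow> instr list \<Rightarrow> bool" where
  "occurs P a Q \<longleftrightarrow> (\<forall>i<length Q. a + i < length P \<and> P ! (a + i) = Q ! i)"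

lemma occurs_append:
  "occurs P a (Q @ Q') \<longleftrightarrow> occurs P a Q \<and> occurs P (a + length Q) Q'"
proof
  assume Q: "occurs P a (Q @ Q')"
  then have "a + length Q + i < length P \<and> P ! (a + length Q + i) = Q' ! i"
    if "i < length Q'" for i
    using that unfolding occurs_def
    by (auto dest: spec[of _ "length Q + i"] simp: nth_append add.assoc)
  with Q show "occurs P a Q \<and> occurs P (a + length Q) Q'"
    by (auto simp: occurs_def nth_append)
next
  assume Q: "occurs P a Q \<and> occurs P (a + length Q) Q'"
  show "occurs P a (Q @ Q')"
    unfolding occurs_def
  proof (intro allI impI)
    fix i assume "i < length (Q @ Q')"
    then show "a + i < length P \<and> P ! (a + i) = (Q @ Q') ! i"
      using Q spec[of _ "i - length Q"] unfolding occurs_def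
      by (cases "i < length Q") (auto simp: nth_append dest: spec[of _ "i - length Q"])
  qed
qed

lemma occurs_Cons: "occurs P a (i # Q) \<longleftrightarrow> a < length P \<and> P ! a = i \<and> occurs P (Suc a) Q"
proof -
  have "occurs P a [i] \<longleftrightarrow> a < length P \<and> P ! a = i"
    by (simp add: occurs_def)
  then show ?thesis
    using occurs_append[of P a "[i]" Q] by simp
qed

definition reaches :: "instr list \<Rightarrow> config \<Rightarrow> config \<Rightarrow> bool" where
  "reaches P c d \<longleftrightarrow> (\<exists>n. (step P ^^ n) c = d)"

lemma reaches_refl: "reaches P c c"
  unfolding reaches_def by (rule exI[of _ 0]) simp

lemma reaches_step:
  assumes "reaches P (step P c) d"
  shows "reaches P c d"
proof -
  from assms obtain n where "(step P ^^ n) (step P c) = d"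
    by (auto simp: reaches_def)
  then have "(step P ^^ Suc n) c = d"
    by (simp add: funpow_swap1)
  then show ?thesis
    unfolding reaches_def by blast
qed

lemma reaches_trans:
  assumes "reaches P c d" "reaches P d e"
  shows "reaches P c e"
proof -
  from assms obtain m n where "(step P ^^ m) c = d" "(step P ^^ n) d = e"
    by (auto simp: reaches_def)
  then have "(step P ^^ (n + m)) c = e"
    by (simp add: funpow_add)
  then show ?thesis
    unfolding reaches_def by blast
qed

lemma code_correct:
  "big_step c R S \<Longrightarrow> occurs P a (code a c) \<Longrightarrow> reaches P (a, R) (a + length (code a c), S)"
proof (induction arbitrary: a rule: big_step.induct)
  case (Skip R)
  then show ?case by (simp add: reaches_refl)
next
  case (Set r e R)
  have "step P (a, R) = (Suc a, R(r := src_val R e))"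
    using Set by (auto simp: occurs_Cons step_def)
  then have "reaches P (a, R) (Suc a, R(r := src_val R e))"
    by (metis reaches_refl reaches_step)
  then show ?case by (simp del: fun_upd_apply)
next
  case (Seq c R S d T)
  then have "reaches P (a, R) (a + length (code a c), S)"
    "reaches P (a + length (code a c), S) (a + length (code a c) + length (code (a + length (code a c)) d), T)"
    by (simp_all add: occurs_append)
  from reaches_trans[OF this] show ?case
    by (simp add: add.assoc)
next
  case (While_0 R r c)
  then have "step P (a, R) = (a + length (code a (While r c)), R)"
    by (simp add: occurs_Cons step_def Let_def)
  then show ?case
    by (metis reaches_refl reaches_step)
next
  case (While R r c S T)
  let ?n = "a + Suc (length (code (Suc a) c))"
  from While.prems have P: "a < length P" "P ! a = Test r (Suc ?n) (Suc a)"
    "occurs P (Suc a) (code (Suc a) c)" "?n < length P" "P ! ?n = Assign Copy a"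
    by (simp_all add: occurs_Cons occurs_append Let_def)
  have "step P (a, R) = (Suc a, R)"
    using P \<open>R r \<noteq> 0\<close> by (simp add: step_def)
  moreover have "reaches P (Suc a, R) (?n, S)"
    using While.IH(1)[OF P(3)] by simp
  moreover have "step P (?n, S) = (a, S)"
    using P by (simp add: step_def)
  ultimately show ?case
    using While.IH(2)[OF While.prems] by (metis reaches_step reaches_trans)
qed

section \<open>Bounds on the registers that are read\<close>

primrec com_within :: "nat \<Rightarrow> com \<Rightarrow> bool" where
  "com_within k Skip \<longleftrightarrow> True"
| "com_within k (Set r e) \<longleftrightarrow> src_within k e"
| "com_within k (Seq c d) \<longleftrightarrow> com_within k c \<and> com_within k d"
| "com_within k (While r c) \<longleftrightarrow> r < k \<and> com_within k c"

lemma src_within_mono: "src_within k e \<Longrightarrow> k \<le> k' \<Longrightarrow> src_within k' e"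
  by (cases e) auto

lemma com_within_mono: "com_within k c \<Longrightarrow> k \<le> k' \<Longrightarrow> com_within k' c"
  by (induction c) (simp_all add: src_within_mono[of k _ k'])

lemma ex_com_within: "\<exists>k. com_within k c"
proof (induction c)
  case (Set r e)
  have "\<exists>k. src_within k e"
    by (cases e) auto
  then show ?case by simp
next
  case (Seq c d)
  then obtain k l where "com_within k c" "com_within l d" by blast
  then have "com_within (max k l) (Seq c d)"
    by (auto intro: com_within_mono)
  then show ?case by blast
next
  case (While r c)
  then obtain k where "com_within k c" by blast
  then have "com_within (max k (Suc r)) (While r c)"
    by (auto intro: com_within_mono)
  then show ?case by blast
qed simp

lemma instr_within_code: "com_within k c \<Longrightarrow> i \<in> set (code a c) \<Longrightarrow> instr_within k i"
proof (induction c arbitrary: a)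
  case (Set r e)
  then show ?case by simp
next
  case (While r c)
  then show ?case by (auto simp: Let_def)
qed auto

text \<open>\<open>compile r as y b\<close> computes \<open>r\<close> from the registers \<open>as\<close> into the register \<open>y\<close>, using the
  registers from \<open>b\<close> on as scratch space.\<close>

fun compile :: "recf \<Rightarrow> nat list \<Rightarrow> nat \<Rightarrow> nat \<Rightarrow> com"
  and compile_list :: "recf list \<Rightarrow> nat list \<Rightarrow> nat \<Rightarrow> nat \<Rightarrow> com" where
  "compile RZero as y b = Set y Clear"
| "compile RSucc as y b = Set y (Incr (hd as))"
| "compile (RProj i) as y b = Set y (Copy (as ! i))"
| "compile (RComp f gs) as y b = Seq (compile_list gs as b (b + length gs))
    (compile f [b..<b + length gs] y (b + length gs))"
| "compile (RPrim f g) as y b =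
    Seq (compile f (tl as) (b + 1) (b + 3))
   (Seq (Set b Clear)
   (Seq (Set (b + 2) (Copy (hd as)))
   (Seq (While (b + 2)
      (Seq (compile g (b # (b + 1) # tl as) (b + 3) (b + 4))
      (Seq (Set (b + 1) (Copy (b + 3)))
      (Seq (Set b (Incr b))
           (Set (b + 2) (Decr (b + 2)))))))
    (Set y (Copy (b + 1))))))"
| "compile (RMin f) as y b =
    Seq (Set b Clear)
   (Seq (compile f (b # as) (b + 1) (b + 2))
   (Seq (While (b + 1) (Seq (Set b (Incr b)) (compile f (b # as) (b + 1) (b + 2))))
    (Set y (Copy b))))"
| "compile_list [] as y b = Skip"
| "compile_list (g # gs) as y b = Seq (compile g as y b) (compile_list gs as (Suc y) b)"

text \<open>Registers from \<open>b\<close> on are scratch space and may be left in any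
  state.\<close>

definition computes :: "com \<Rightarrow> nat \<Rightarrow> nat \<Rightarrow> (nat \<Rightarrow> nat) \<Rightarrow> nat \<Rightarrow> bool" where
  "computes c y b R v \<longleftrightarrow> (\<exists>S. big_step c R S \<and> S y = v \<and> (\<forall>i<b. i \<noteq> y \<longrightarrow> S i = R i))"

inductive_cases rec_eval_compE: "rec_eval (RComp f gs) xs z"
inductive_cases rec_eval_primE: "rec_eval (RPrim f g) xs z"
inductive_cases rec_eval_minE: "rec_eval (RMin f) xs z"
inductive_cases rec_eval_succE: "rec_eval RSucc xs z"
inductive_cases rec_eval_zeroE: "rec_eval RZero xs z"
inductive_cases rec_eval_projE: "rec_eval (RProj i) xs z"

text \<open>Unwinds a primitive recursion into the sequence of its intermediate values, to which the
  loop invariant of the compiled code refers.\<close>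

lemma rec_eval_prim_values:
  "rec_eval (RPrim f g) (n # xs) y \<Longrightarrow>
    \<exists>v. rec_eval f xs (v 0) \<and> (\<forall>m<n. rec_eval g (m # v m # xs) (v (Suc m))) \<and> v n = y"
proof (induction n arbitrary: y)
  case 0
  then show ?case by (auto elim: rec_eval_primE)
next
  case (Suc n)
  then obtain z where z: "rec_eval (RPrim f g) (n # xs) z" "rec_eval g (n # z # xs) y"
    by (auto elim: rec_eval_primE)
  with Suc.IH obtain v where "rec_eval f xs (v 0)"
    "\<forall>m<n. rec_eval g (m # v m # xs) (v (Suc m))" "v n = z"
    by blast
  with z show ?case
    by (intro exI[of _ "v(Suc n := y)"]) (auto simp: less_Suc_eq)
qed

text \<open>The results occupy consecutive registers above all arguments, so storing one result
  disturbs neither the arguments nor the earlier results.\<close>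

lemma compile_list_correct:
  assumes "\<And>g R xs y b v. g \<in> set gs \<Longrightarrow> rec_eval g xs v \<Longrightarrow> map R as = xs
      \<Longrightarrow> \<forall>a\<in>set as. a < b \<Longrightarrow> y < b \<Longrightarrow> computes (compile g as y b) y b R v"
    and "list_all2 (\<lambda>g v. rec_eval g xs v) gs vs" "map R as = xs"
    and "\<forall>a\<in>set as. a < y" "y + length gs \<le> b"
  shows "\<exists>S. big_step (compile_list gs as y b) R S \<and> map S [y..<y + length gs] = vs \<and>
    (\<forall>i<b. i < y \<or> y + length gs \<le> i \<longrightarrow> S i = R i)"
  using assms
proof (induction gs arbitrary: y vs R)
  case Nil
  then show ?case by (auto intro: big_step.Skip)
next
  case (Cons g gs)
  from Cons.prems(2) obtain v vs' where vs: "vs = v # vs'" "rec_eval g xs v"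
    "list_all2 (\<lambda>g v. rec_eval g xs v) gs vs'"
    by (auto simp: list_all2_Cons1)
  have "computes (compile g as y b) y b R v"
    using Cons.prems vs(2) by (intro Cons.prems(1)[where xs = xs]) auto
  then obtain S where S: "big_step (compile g as y b) R S" "S y = v" "\<forall>i<b. i \<noteq> y \<longrightarrow> S i = R i"
    by (auto simp: computes_def)
  have "\<exists>T. big_step (compile_list gs as (Suc y) b) S T \<and> map T [Suc y..<Suc y + length gs] = vs' \<and>
    (\<forall>i<b. i < Suc y \<or> Suc y + length gs \<le> i \<longrightarrow> T i = S i)"
  proof (rule Cons.IH[OF Cons.prems(1) vs(3)])
    show "map S as = xs"
      using Cons.prems(3-5) S(3) by (auto intro!: map_cong[OF refl])
  qed (use Cons.prems in auto)
  then obtain T where T: "big_step (compile_list gs as (Suc y) b) S T"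
    "map T [Suc y..<Suc y + length gs] = vs'" "\<forall>i<b. i < Suc y \<or> Suc y + length gs \<le> i \<longrightarrow> T i = S i"
    by blast
  have "[y..<y + length (g # gs)] = y # [Suc y..<Suc y + length gs]"
    by (simp add: upt_rec)
  with S T vs(1) Cons.prems(5) show ?case
    by (intro exI[of _ T]) (auto intro: big_step.Seq)
qed

lemma compile_correct:
  "rec_eval r xs v \<Longrightarrow> map R as = xs \<Longrightarrow> \<forall>a\<in>set as. a < b \<Longrightarrow> y < b
    \<Longrightarrow> computes (compile r as y b) y b R v"
proof (induction r arbitrary: as xs y b R v)
  case RZero
  then show ?case
    by (auto simp: computes_def elim!: rec_eval_zeroE intro!: exI[of _ "R(y := 0)"] big_step_Set)
next
  case RSucc
  then show ?case
    by (auto simp: computes_def elim!: rec_eval_succE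
        intro!: exI[of _ "R(y := v)"] big_step_Set)
next
  case (RProj i)
  then show ?case
    by (auto simp: computes_def elim!: rec_eval_projE intro!: exI[of _ "R(y := v)"] big_step_Set)
next
  case (RComp f gs)
  from RComp.prems(1) obtain vs where vs: "list_all2 (\<lambda>g v. rec_eval g xs v) gs vs" "rec_eval f vs v"
    by (auto elim: rec_eval_compE)
  let ?b = "b + length gs"
  have "\<exists>S. big_step (compile_list gs as b ?b) R S \<and> map S [b..<b + length gs] = vs \<and>
      (\<forall>i<?b. i < b \<or> b + length gs \<le> i \<longrightarrow> S i = R i)"
    using RComp.prems by (intro compile_list_correct[OF RComp.IH(2) vs(1)]) auto
  then obtain S where S: "big_step (compile_list gs as b ?b) R S" "map S [b..<?b] = vs"
    "\<forall>i<b. S i = R i"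
    by auto
  then have "computes (compile f [b..<?b] y ?b) y ?b S v"
    using RComp.prems by (intro RComp.IH(1)[OF vs(2)]) auto
  with S show ?case
    by (auto simp: computes_def intro: big_step.Seq)
next
  case (RPrim f g)
  from RPrim.prems(1) obtain n xs' where xs: "xs = n # xs'"
    by (auto elim: rec_eval_primE)
  with RPrim.prems(2) obtain a as' where as: "as = a # as'" "R a = n" "map R as' = xs'"
    by auto
  from rec_eval_prim_values RPrim.prems(1) xs obtain w where w: "rec_eval f xs' (w 0)"
    "\<forall>m<n. rec_eval g (m # w m # xs') (w (Suc m))" "w n = v"
    by blast
  have "computes (compile f as' (b + 1) (b + 3)) (b + 1) (b + 3) R (w 0)"
    using RPrim.prems as by (intro RPrim.IH(1)[OF w(1)]) auto
  then obtain S where S: "big_step (compile f as' (b + 1) (b + 3)) R S" "S (b + 1) = w 0"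
    "\<forall>i<b. S i = R i"
    by (auto simp: computes_def)
  let ?body = "Seq (compile g (b # (b + 1) # as') (b + 3) (b + 4)) (Seq (Set (b + 1) (Copy (b + 3)))
      (Seq (Set b (Incr b)) (Set (b + 2) (Decr (b + 2)))))"
  \<comment> \<open>Loop invariant: after \<open>m\<close> rounds register \<open>b\<close> holds
    \<open>m\<close>, \<open>b + 1\<close> the intermediate value \<open>w m\<close>, and
    \<open>b + 2\<close> the number of remaining rounds.\<close>
  have loop: "\<exists>U. big_step (While (b + 2) ?body) T U \<and> U (b + 1) = v \<and> (\<forall>i<b. U i = R i)"
    if "m \<le> n" "T b = m" "T (b + 1) = w m" "T (b + 2) = n - m" "\<forall>i<b. T i = R i" for m T
    using that
  proof (induction m arbitrary: T rule: inc_induct)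
    case base
    then show ?case
      using w(3) by (auto intro!: exI[of _ T] big_step.While_0)
  next
    case (step m)
    have "map T as' = xs'"
      using step.prems(4) RPrim.prems(3) as by (auto intro: map_cong)
    then have "computes (compile g (b # (b + 1) # as') (b + 3) (b + 4)) (b + 3) (b + 4) T (w (Suc m))"
      using RPrim.prems as step by (intro RPrim.IH(2)[OF w(2)[rule_format, OF \<open>m < n\<close>]]) auto
    then obtain U where U: "big_step (compile g (b # (b + 1) # as') (b + 3) (b + 4)) T U"
      "U (b + 3) = w (Suc m)" "\<forall>i<b + 3. U i = T i"
      by (auto simp: computes_def)
    let ?U = "U(b + 1 := w (Suc m), b := Suc m, b + 2 := n - Suc m)"
    let ?U1 = "U(b + 1 := src_val U (Copy (b + 3)))"
    let ?U2 = "?U1(b := src_val ?U1 (Incr b))"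
    have "?U2(b + 2 := src_val ?U2 (Decr (b + 2))) = ?U"
      using U(2,3) step.prems(1,3) by (auto simp: fun_eq_iff)
    moreover have "big_step ?body T (?U2(b + 2 := src_val ?U2 (Decr (b + 2))))"
      by (intro big_step.Seq[OF U(1)] big_step.Seq[OF big_step.Set] big_step.Set)
    ultimately have body: "big_step ?body T ?U"
      by simp
    have "\<exists>V. big_step (While (b + 2) ?body) ?U V \<and> V (b + 1) = v \<and> (\<forall>i<b. V i = R i)"
      using U(3) step.prems(4) by (intro step.IH) auto
    moreover have "T (b + 2) \<noteq> 0"
      using step.hyps step.prems(3) by simp
    ultimately show ?case
      using body big_step.While by blast
  qed
  let ?T = "S(b := 0, b + 2 := n)"
  have "\<exists>U. big_step (While (b + 2) ?body) ?T U \<and> U (b + 1) = v \<and> (\<forall>i<b. U i = R i)"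
    using S by (intro loop[of 0]) auto
  then obtain U where U: "big_step (While (b + 2) ?body) ?T U" "U (b + 1) = v" "\<forall>i<b. U i = R i"
    by blast
  have "a < b" "S a = n"
    using RPrim.prems(3) S(3) as by auto
  then have init: "big_step (Set (b + 2) (Copy a)) (S(b := 0)) ?T"
    by (intro big_step_Set) auto
  have "big_step (Set b Clear) S (S(b := 0))" "big_step (Set y (Copy (b + 1))) U (U(y := v))"
    using U(2) by (auto intro: big_step_Set)
  then have "big_step (compile (RPrim f g) as y b) R (U(y := v))"
    unfolding compile.simps as list.sel by (intro big_step.Seq[OF S(1)] big_step.Seq[OF _ big_step.Seq[OF init]] big_step.Seq[OF U(1)])
  with U RPrim.prems(4) show ?case
    by (auto simp: computes_def intro!: exI[of _ "U(y := v)"])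
next
  case (RMin f)
  from RMin.prems(1) have v: "rec_eval f (v # xs) 0" "\<forall>m<v. \<exists>k. rec_eval f (m # xs) (Suc k)"
    by (auto elim: rec_eval_minE)
  have test: "computes (compile f (b # as) (b + 1) (b + 2)) (b + 1) (b + 2) T k"
    if "rec_eval f (m # xs) k" "T b = m" "\<forall>i<b. T i = R i" for m k T
  proof (rule RMin.IH[OF that(1)])
    show "map T (b # as) = m # xs"
      using that RMin.prems(2,3) by (auto intro: map_cong)
  qed (use RMin.prems in auto)
  let ?body = "Seq (Set b (Incr b)) (compile f (b # as) (b + 1) (b + 2))"
  \<comment> \<open>Loop invariant: register \<open>b\<close> holds the candidate \<open>m\<close>,
    and \<open>b + 1\<close> the value of \<open>f\<close> there.\<close>
  have loop: "\<exists>U. big_step (While (b + 1) ?body) T U \<and> U b = v \<and> (\<forall>i<b. U i = R i)"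
    if "m \<le> v" "T b = m" "rec_eval f (m # xs) (T (b + 1))" "\<forall>i<b. T i = R i" for m T
    using that
  proof (induction m arbitrary: T rule: inc_induct)
    case base
    then have "T (b + 1) = 0"
      using v(1) rec_eval_deterministic by blast
    with base show ?case
      by (auto intro!: exI[of _ T] big_step.While_0)
  next
    case (step m)
    \<comment> \<open>Below \<open>v\<close> convergence comes from the positive values, at
      \<open>v\<close> itself from the zero.\<close>
    from v step.hyps have "\<exists>k. rec_eval f (Suc m # xs) k"
      by (cases "Suc m = v") (auto dest: Suc_lessI)
    then obtain k where k: "rec_eval f (Suc m # xs) k" by blast
    from test[OF k, of "T(b := Suc m)"] step.prems obtain U
      where U: "big_step (compile f (b # as) (b + 1) (b + 2)) (T(b := Suc m)) U" "U (b + 1) = k"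
        "U b = Suc m" "\<forall>i<b. U i = R i"
      by (auto simp: computes_def)
    have "big_step ?body T U"
      using step.prems(1) U(1) by (intro big_step.Seq[OF big_step_Set U(1)]) auto
    moreover have "\<exists>V. big_step (While (b + 1) ?body) U V \<and> V b = v \<and> (\<forall>i<b. V i = R i)"
      using U k by (intro step.IH) auto
    moreover have "T (b + 1) \<noteq> 0"
      using step.prems(2) step.hyps v(2) rec_eval_deterministic by (metis nat.distinct(1))
    ultimately show ?case
      using big_step.While by blast
  qed
  from v have "\<exists>k. rec_eval f (0 # xs) k"
    by (cases "v = 0") auto
  then obtain k where k: "rec_eval f (0 # xs) k" by blast
  from test[OF k, of "R(b := 0)"] obtain S
    where S: "big_step (compile f (b # as) (b + 1) (b + 2)) (R(b := 0)) S" "S (b + 1) = k"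
      "S b = 0" "\<forall>i<b. S i = R i"
    by (auto simp: computes_def)
  then have "\<exists>U. big_step (While (b + 1) ?body) S U \<and> U b = v \<and> (\<forall>i<b. U i = R i)"
    using k by (intro loop[of 0]) auto
  then obtain U where U: "big_step (While (b + 1) ?body) S U" "U b = v" "\<forall>i<b. U i = R i"
    by blast
  have "big_step (Set b Clear) R (R(b := 0))" "big_step (Set y (Copy b)) U (U(y := v))"
    using U(2) by (auto intro: big_step_Set)
  then have "big_step (compile (RMin f) as y b) R (U(y := v))"
    unfolding compile.simps by (intro big_step.Seq[OF _ big_step.Seq[OF S(1)]] big_step.Seq[OF U(1)])
  with U RMin.prems(4) show ?case
    by (auto simp: computes_def intro!: exI[of _ "U(y := v)"])
qed

text \<open>The final test sits at the last address \<open>n\<close>, so \<open>Suc n\<close> is the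
  trap counter and \<open>Suc (Suc n)\<close> the escape counter; register 2 holds the computed
  value.\<close>

definition program :: "recf \<Rightarrow> instr list" where
  "program r = (let Q = code 1 (compile r [0, 1] 2 3); n = Suc (length Q) in
    init_instr # Q @ [Test 2 (Suc n) (Suc (Suc n))])"

theorem program_correct:
  assumes "rec_eval r [x, y] v"
  shows "\<exists>n. fst ((step (program r) ^^ n) (initial x y)) =
    (if v = 0 then length (program r) else Suc (length (program r)))"
proof -
  let ?c = "compile r [0, 1] 2 3" and ?P = "program r"
  define n where "n = Suc (length (code 1 ?c))"
  have len: "length ?P = Suc n"
    by (simp add: program_def n_def Let_def)
  have "occurs ?P 0 ?P"
    by (simp add: occurs_def)
  then have occ: "?P ! 0 = init_instr" "occurs ?P 1 (code 1 ?c)" "?P ! n = Test 2 (Suc n) (Suc (Suc n))"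
    by (auto simp: program_def n_def Let_def occurs_def nth_append)
  let ?R = "(\<lambda>_. 0)(0 := x, 1 := y)"
  have "computes ?c 2 3 ?R v"
    by (rule compile_correct[OF assms]) auto
  then obtain S where S: "big_step ?c ?R S" "S 2 = v"
    by (auto simp: computes_def)
  have "step ?P (initial x y) = (1, ?R)"
    using occ(1) by (auto simp: step_def initial_def init_instr_def len)
  moreover have "reaches ?P (1, ?R) (n, S)"
    using code_correct[OF S(1) occ(2)] by (simp add: n_def)
  moreover have "step ?P (n, S) = (if v = 0 then length ?P else Suc (length ?P), S)"
    using occ(3) S(2) by (simp add: step_def len)
  ultimately have "reaches ?P (initial x y) (if v = 0 then length ?P else Suc (length ?P), S)"
    by (metis reaches_refl reaches_step reaches_trans)
  then obtain m where "(step ?P ^^ m) (initial x y) = (if v = 0 then length ?P else Suc (length ?P), S)"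
    by (auto simp: reaches_def)
  then show ?thesis
    by (intro exI[of _ m]) simp
qed

theorem ex_program_form:
  "\<exists>\<alpha>. \<forall>x y. (rec_eval r [x, y] 0 \<longrightarrow> run_sequent \<alpha> x y \<in> ACT_meet) \<and>
    (rec_eval r [x, y] 1 \<longrightarrow> run_sequent \<alpha> x y \<notin> ACT_omega_meet)"
proof -
  let ?P = "program r"
  obtain k0 where k0: "com_within k0 (compile r [0, 1] 2 3)"
    using ex_com_within by blast
  \<comment> \<open>Register 2 is read by the final test, so at least three registers are
    tracked.\<close>
  define k where "k = max k0 3"
  have k: "com_within k (compile r [0, 1] 2 3)"
    using k0 by (rule com_within_mono) (simp add: k_def)
  have "instr_within k init_instr"
    by (auto simp: init_instr_def)
  moreover have "instr_within k (Test 2 l m)" for l m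
    by (simp add: k_def)
  ultimately have within: "\<forall>i\<in>set ?P. instr_within k i"
    using instr_within_code[OF k] by (auto simp: program_def Let_def)
  have "run_sequent (program_form k ?P) x y \<in> ACT_meet" if eval: "rec_eval r [x, y] 0" for x y
  proof -
    let ?trapped = "\<lambda>n. fst ((step ?P ^^ n) (initial x y)) \<ge> length ?P"
    obtain m where m: "fst ((step ?P ^^ m) (initial x y)) = length ?P"
      using program_correct[OF eval] by auto
    have stay: "step ?P c = c" if "fst c \<ge> length ?P" for c
      using that by (simp add: step_def)
    \<comment> \<open>The first time at which the counter lies outside the program. The
      configuration no longer changes from then on, so the counter already equals
      \<open>length ?P\<close>.\<close>
    define n where "n = (LEAST n. ?trapped n)"
    have trapped: "?trapped n"
      unfolding n_def using m by (intro LeastI[of ?trapped m]) simp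
    have "n \<le> m"
      unfolding n_def using m by (intro Least_le[of ?trapped]) simp
    then have "(step ?P ^^ m) (initial x y) = (step ?P ^^ (m - n)) ((step ?P ^^ n) (initial x y))"
      using funpow_add[of "m - n" n "step ?P"] by simp
    moreover have "(step ?P ^^ j) c = c" if "fst c \<ge> length ?P" for j c
      using stay[OF that] by (induction j) auto
    ultimately have "fst ((step ?P ^^ n) (initial x y)) = length ?P"
      using m trapped by simp
    moreover have "fst ((step ?P ^^ j) (initial x y)) < length ?P" if "j < n" for j
      using not_less_Least[of j ?trapped] that by (simp add: n_def)
    ultimately show ?thesis
      using within by (intro run_sequent_provable[where n = n]) (simp_all add: program_def Let_def)
  qed
  moreover have "run_sequent (program_form k ?P) x y \<notin> ACT_omega_meet" if "rec_eval r [x, y] 1" for x y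
    using program_correct[OF that] run_sequent_refutable by auto
  ultimately show ?thesis by blast
qed


section \<open>Arithmetic of sequent codes\<close>

lemma rec_eval_proj [simp]: "rec_eval (RProj i) xs y \<longleftrightarrow> i < length xs \<and> y = xs ! i"
  by (auto elim: rec_eval_projE intro: rec_eval.proj)

lemma rec_eval_projI: "i < length xs \<Longrightarrow> y = xs ! i \<Longrightarrow> rec_eval (RProj i) xs y"
  by simp

lemma rec_eval_comp1: "rec_eval g xs a \<Longrightarrow> rec_eval f [a] z \<Longrightarrow> rec_eval (RComp f [g]) xs z"
  by (rule rec_eval.comp[where ys = "[a]"]) simp_all

lemma rec_eval_comp2:
  "rec_eval g xs a \<Longrightarrow> rec_eval h xs b \<Longrightarrow> rec_eval f [a, b] z \<Longrightarrow> rec_eval (RComp f [g, h]) xs z"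
  by (rule rec_eval.comp[where ys = "[a, b]"]) simp_all

lemma rec_eval_comp3:
  "rec_eval g xs a \<Longrightarrow> rec_eval h xs b \<Longrightarrow> rec_eval k xs c \<Longrightarrow> rec_eval f [a, b, c] z
    \<Longrightarrow> rec_eval (RComp f [g, h, k]) xs z"
  by (rule rec_eval.comp[where ys = "[a, b, c]"]) simp_all

primrec r_const :: "nat \<Rightarrow> recf" where
  "r_const 0 = RZero"
| "r_const (Suc n) = RComp RSucc [r_const n]"

lemma rec_eval_const: "rec_eval (r_const n) xs n"
  by (induction n) (auto intro: rec_eval.zero rec_eval_comp1 rec_eval.succ)

definition r_pred :: recf where "r_pred = RPrim RZero (RProj 0)"

lemma rec_eval_pred: "rec_eval r_pred [n] (n - 1)"
  unfolding r_pred_def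
proof (induction n)
  case (Suc n)
  then show ?case by (rule rec_eval.prim_Suc) simp
qed (simp add: rec_eval.prim_0 rec_eval.zero)

definition r_add :: recf where "r_add = RPrim (RProj 0) (RComp RSucc [RProj 1])"

lemma rec_eval_add: "rec_eval r_add [m, n] (m + n)"
  unfolding r_add_def
proof (induction m)
  case (Suc m)
  have "rec_eval (RComp RSucc [RProj 1]) [m, m + n, n] (Suc (m + n))"
    by (rule rec_eval_comp1[OF rec_eval_projI rec_eval.succ]) simp_all
  with Suc show ?case by (auto intro: rec_eval.prim_Suc)
qed (simp add: rec_eval.prim_0)

text \<open>Recursion runs over the subtrahend, which is therefore the first argument.\<close>

definition r_diff :: recf where "r_diff = RPrim (RProj 0) (RComp r_pred [RProj 1])"

lemma rec_eval_diff: "rec_eval r_diff [m, n] (n - m)"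
  unfolding r_diff_def
proof (induction m)
  case (Suc m)
  have "rec_eval (RComp r_pred [RProj 1]) [m, n - m, n] (n - m - 1)"
    by (rule rec_eval_comp1[OF rec_eval_projI rec_eval_pred]) simp_all
  with Suc show ?case by (auto intro: rec_eval.prim_Suc)
qed (simp add: rec_eval.prim_0)

text \<open>In the recursion step the arguments are the predecessor, the previous value, and the two
  branches, so projection 3 returns the second branch.\<close>

definition r_if :: recf where "r_if = RPrim (RProj 0) (RProj 3)"

lemma rec_eval_if: "rec_eval r_if [c, a, b] (if c = 0 then a else b)"
proof (cases c)
  case 0
  then show ?thesis
    unfolding r_if_def by (simp add: rec_eval.prim_0)
next
  case (Suc n)
  have "\<exists>y. rec_eval r_if [n, a, b] y" for n
    unfolding r_if_def
  proof (induction n)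
    case 0
    show ?case by (intro exI rec_eval.prim_0) simp
  next
    case (Suc n)
    then obtain y where "rec_eval (RPrim (RProj 0) (RProj 3)) [n, a, b] y" by blast
    then have "rec_eval (RPrim (RProj 0) (RProj 3)) [Suc n, a, b] b"
      by (rule rec_eval.prim_Suc) simp
    then show ?case by blast
  qed
  then obtain y where "rec_eval r_if [n, a, b] y" by blast
  then have "rec_eval r_if [Suc n, a, b] b"
    unfolding r_if_def by (rule rec_eval.prim_Suc) simp
  with Suc show ?thesis by simp
qed

text \<open>Composition is strict: both branches must converge, whichever is selected. This is one
  reason to work with total approximations below.\<close>

lemma rec_eval_if':
  "rec_eval r xs c \<Longrightarrow> rec_eval s xs a \<Longrightarrow> rec_eval t xs b
    \<Longrightarrow> rec_eval (RComp r_if [r, s, t]) xs (if c = 0 then a else b)"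
  by (rule rec_eval_comp3[OF _ _ _ rec_eval_if])

section \<open>Pairing, list codes and the code of a sequent about its own program\<close>

definition r_triangle :: recf where
  "r_triangle = RPrim RZero (RComp r_add [RComp RSucc [RProj 0], RProj 1])"

lemma rec_eval_triangle: "rec_eval r_triangle [n] (triangle n)"
  unfolding r_triangle_def
proof (induction n)
  case (Suc n)
  have "rec_eval (RComp r_add [RComp RSucc [RProj 0], RProj 1]) [n, triangle n]
      (Suc n + triangle n)"
    by (rule rec_eval_comp2[OF rec_eval_comp1[OF rec_eval_projI rec_eval.succ] rec_eval_projI
          rec_eval_add]) simp_all
  with Suc show ?case by (auto intro: rec_eval.prim_Suc simp: add.commute)
qed (auto intro: rec_eval.prim_0 rec_eval.zero)

definition r_pair :: recf where "r_pair = RComp r_add [RComp r_triangle [r_add], RProj 0]"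

lemma rec_eval_pair: "rec_eval r_pair [m, n] (prod_encode (m, n))"
  unfolding r_pair_def prod_encode_def prod.case
  by (rule rec_eval_comp2[OF rec_eval_comp1[OF rec_eval_add rec_eval_triangle] rec_eval_projI
        rec_eval_add]) simp_all

definition r_cons :: recf where "r_cons = RComp RSucc [r_pair]"

lemma rec_eval_cons: "rec_eval r_cons [x, list_encode xs] (list_encode (x # xs))"
  unfolding r_cons_def list_encode.simps by (rule rec_eval_comp1[OF rec_eval_pair rec_eval.succ])

definition r_prepend :: "nat \<Rightarrow> recf" where
  "r_prepend x = RPrim (RProj 0) (RComp r_cons [r_const x, RProj 1])"

lemma rec_eval_prepend:
  "rec_eval (r_prepend x) [n, list_encode xs] (list_encode (replicate n x @ xs))"
  unfolding r_prepend_def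
proof (induction n)
  case (Suc n)
  have "rec_eval (RComp r_cons [r_const x, RProj 1]) [n, list_encode (replicate n x @ xs), list_encode xs]
      (list_encode (x # replicate n x @ xs))"
    by (rule rec_eval_comp2[OF rec_eval_const rec_eval_projI rec_eval_cons]) simp_all
  with Suc show ?case by (auto intro: rec_eval.prim_Suc)
qed (simp add: rec_eval.prim_0)

text \<open>Here \<open>c\<close> is both the number of copies of the second input formula and the
  code of the last formula, so that the machine is run on its own code.\<close>

definition self_code :: "nat \<Rightarrow> nat \<Rightarrow> nat" where
  "self_code x c = prod_encode (list_encode (form_code start_form # replicate x (form_code (input_form 0))
     @ replicate c (form_code (input_form 1)) @ [c]), form_code good)"

lemma sequent_code_run_sequent:
  "sequent_code (run_sequent \<alpha> x (form_code \<alpha>)) = self_code x (form_code \<alpha>)"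
  by (simp add: sequent_code_def run_sequent_def self_code_def)

definition r_self_code :: recf where
  "r_self_code = RComp r_pair [RComp r_cons [r_const (form_code start_form),
     RComp (r_prepend (form_code (input_form 0))) [RProj 0,
     RComp (r_prepend (form_code (input_form 1))) [RProj 1, RComp r_cons [RProj 1, RZero]]]],
     r_const (form_code good)]"

lemma rec_eval_self_code: "rec_eval r_self_code [x, c] (self_code x c)"
proof -
  have 1: "rec_eval (RComp r_cons [RProj 1, RZero]) [x, c] (list_encode [c])"
    by (rule rec_eval_comp2[OF rec_eval_projI rec_eval.zero])
      (use rec_eval_cons[of c "[]"] in simp_all)
  have proj: "rec_eval (RProj 0) [x, c] x" "rec_eval (RProj 1) [x, c] c"
    by (simp_all add: rec_eval_projI)
  show ?thesis
    unfolding r_self_code_def self_code_def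
    by (intro rec_eval_comp2[OF _ rec_eval_const rec_eval_pair]
        rec_eval_comp2[OF rec_eval_const _ rec_eval_cons]
        rec_eval_comp2[OF proj(1) _ rec_eval_prepend] rec_eval_comp2[OF proj(2) 1 rec_eval_prepend])
qed

lemma total_recursiveI: "(\<And>x. rec_eval r [x] (f x)) \<Longrightarrow> total_recursive f"
  unfolding total_recursive_def using rec_eval_deterministic by blast

section \<open>Step-bounded evaluation\<close>

text \<open>The value \<open>0\<close> of an approximation \<open>g\<close> means that no result has been found within the bound,
  and \<open>Suc y\<close> that the result is \<open>y\<close>.\<close>

definition approximates :: "recf \<Rightarrow> (nat \<Rightarrow> nat list \<Rightarrow> nat) \<Rightarrow> recf \<Rightarrow> nat \<Rightarrow> bool" where
  "approximates a g r n \<longleftrightarrow>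
    (\<forall>t xs. length xs = n \<longrightarrow> rec_eval a (t # xs) (g t xs)) \<and>
    (\<forall>t xs y. length xs = n \<longrightarrow> g t xs = Suc y \<longrightarrow> rec_eval r xs y) \<and>
    (\<forall>xs y. length xs = n \<longrightarrow> rec_eval r xs y \<longrightarrow> (\<exists>T. \<forall>t\<ge>T. g t xs = Suc y))"

lemma approximatesI:
  assumes "\<And>t xs. length xs = n \<Longrightarrow> rec_eval a (t # xs) (g t xs)"
    and "\<And>t xs y. length xs = n \<Longrightarrow> g t xs = Suc y \<Longrightarrow> rec_eval r xs y"
    and "\<And>xs y. length xs = n \<Longrightarrow> rec_eval r xs y \<Longrightarrow> \<exists>T. \<forall>t\<ge>T. g t xs = Suc y"
  shows "approximates a g r n"
  using assms by (simp add: approximates_def)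

lemma approximatesD:
  assumes "approximates a g r n" "length xs = n"
  shows "rec_eval a (t # xs) (g t xs)" "g t xs = Suc y \<Longrightarrow> rec_eval r xs y"
    "rec_eval r xs y \<Longrightarrow> \<exists>T. \<forall>t\<ge>T. g t xs = Suc y"
  using assms by (simp_all add: approximates_def)

lemma approximates_converges_iff:
  assumes "approximates a g r n" "length xs = n"
  shows "(\<exists>y. rec_eval r xs y) \<longleftrightarrow> (\<exists>t. g t xs \<noteq> 0)"
proof
  assume "\<exists>y. rec_eval r xs y"
  then obtain y T where "\<forall>t\<ge>T. g t xs = Suc y"
    using approximatesD(3)[OF assms] by blast
  then show "\<exists>t. g t xs \<noteq> 0" by (intro exI[of _ T]) simp
next
  assume "\<exists>t. g t xs \<noteq> 0"
  then obtain t y where "g t xs = Suc y" by (auto simp: not0_implies_Suc gr0_conv_Suc)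
  then show "\<exists>y. rec_eval r xs y"
    using approximatesD(2)[OF assms] by blast
qed

text \<open>Handles arities that do not fit a term, for which it is nowhere defined.\<close>

lemma approximates_undefined:
  assumes "\<And>xs y. length xs = n \<Longrightarrow> \<not> rec_eval r xs y"
  shows "approximates RZero (\<lambda>_ _. 0) r n"
  using assms by (auto intro: approximatesI rec_eval.zero)

lemma list_all2_map_proj:
  "zs = ys @ xs \<Longrightarrow>
    list_all2 (\<lambda>g y. rec_eval g zs y) (map RProj [length ys..<length ys + length xs]) xs"
  by (auto simp: list_all2_conv_all_nth nth_append intro!: rec_eval_projI)

primrec r_all :: "recf list \<Rightarrow> recf" where
  "r_all [] = r_const 1"
| "r_all (r # rs) = RComp r_if [r, RZero, r_all rs]"

lemma rec_eval_all:
  assumes "\<And>r. r \<in> set rs \<Longrightarrow> rec_eval (f r) xs (v r)"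
  shows "rec_eval (r_all (map f rs)) xs (if \<exists>r\<in>set rs. v r = 0 then 0 else 1)"
  using assms
proof (induction rs)
  case (Cons r rs)
  have "rec_eval (r_all (map f (r # rs))) xs
      (if v r = 0 then 0 else if \<exists>r\<in>set rs. v r = 0 then 0 else 1)"
    using Cons unfolding list.map r_all.simps
    by (intro rec_eval_if' rec_eval.zero) simp_all
  also have "(if v r = 0 then 0 else if \<exists>r\<in>set rs. v r = 0 then 0 else 1) =
      (if \<exists>r\<in>set (r # rs). v r = 0 then 0 else (1::nat))"
    by simp
  finally show ?case .
qed (use rec_eval_const[of 1] in simp)

lemma approximates_comp:
  assumes f: "approximates af gf f (length gs)"
    and g: "\<And>h. h \<in> set gs \<Longrightarrow> approximates (ag h) (gg h) h n"
  shows "\<exists>a g. approximates a g (RComp f gs) n"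
proof -
  \<comment> \<open>The approximation \<open>af\<close> is evaluated even when a component has
    failed; as it is total, this converges, and the result is then discarded.\<close>
  define a where "a = RComp r_if [r_all (map ag gs), RZero,
    RComp af (RProj 0 # map (\<lambda>h. RComp r_pred [ag h]) gs)]"
  define g' where "g' t xs = (if (if \<exists>h\<in>set gs. gg h t xs = 0 then 0 else 1 :: nat) = 0 then 0
    else gf t (map (\<lambda>h. gg h t xs - 1) gs))" for t xs
  have "approximates a g' (RComp f gs) n"
  proof (rule approximatesI)
    fix t and xs :: "nat list" assume xs: "length xs = n"
    have ag: "rec_eval (ag h) (t # xs) (gg h t xs)" if "h \<in> set gs" for h
      using approximatesD(1)[OF g[OF that] xs] .
    have "rec_eval (RComp af (RProj 0 # map (\<lambda>h. RComp r_pred [ag h]) gs)) (t # xs)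
        (gf t (map (\<lambda>h. gg h t xs - 1) gs))"
    proof (rule rec_eval.comp)
      show "list_all2 (\<lambda>g y. rec_eval g (t # xs) y)
          (RProj 0 # map (\<lambda>h. RComp r_pred [ag h]) gs) (t # map (\<lambda>h. gg h t xs - 1) gs)"
        using ag by (auto simp: list_all2_map1 list_all2_map2 list_all2_same
            intro: rec_eval_comp1 rec_eval_pred[unfolded One_nat_def])
    qed (simp add: approximatesD(1)[OF f])
    then show "rec_eval a (t # xs) (g' t xs)"
      unfolding a_def g'_def by (intro rec_eval_if' rec_eval_all ag rec_eval.zero)
  next
    fix t xs y assume xs: "length xs = n" and y: "g' t xs = Suc y"
    have "rec_eval h xs (gg h t xs - 1)" if "h \<in> set gs" for h
      using approximatesD(2)[OF g[OF that] xs] y that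
      by (auto simp: g'_def split: if_splits)
    then have "list_all2 (\<lambda>h y. rec_eval h xs y) gs (map (\<lambda>h. gg h t xs - 1) gs)"
      by (simp add: list_all2_map2 list_all2_same)
    moreover have "rec_eval f (map (\<lambda>h. gg h t xs - 1) gs) y"
      using y by (intro approximatesD(2)[OF f, where t = t]) (auto simp: g'_def split: if_splits)
    ultimately show "rec_eval (RComp f gs) xs y"
      by (rule rec_eval.comp)
  next
    fix xs y assume xs: "length xs = n" and "rec_eval (RComp f gs) xs y"
    then obtain ys where ys: "list_all2 (\<lambda>h y. rec_eval h xs y) gs ys" "rec_eval f ys y"
      by (auto elim: rec_eval_compE)
    from ys(1) g have "\<exists>T. \<forall>t\<ge>T. list_all2 (\<lambda>h y. gg h t xs = Suc y) gs ys"
    proof (induction rule: list_all2_induct)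
      case (Cons h hs y ys)
      then obtain T where "\<forall>t\<ge>T. list_all2 (\<lambda>h y. gg h t xs = Suc y) hs ys"
        by auto
      moreover obtain T' where "\<forall>t\<ge>T'. gg h t xs = Suc y"
        using approximatesD(3)[OF Cons(4) xs Cons(1)] by auto
      ultimately show ?case
        by (intro exI[of _ "max T T'"]) auto
    qed simp
    then obtain T where T: "\<forall>t\<ge>T. list_all2 (\<lambda>h y. gg h t xs = Suc y) gs ys" by blast
    obtain T' where T': "\<forall>t\<ge>T'. gf t ys = Suc y"
      using approximatesD(3)[OF f _ ys(2)] list_all2_lengthD[OF ys(1)] by auto
    have "g' t xs = Suc y" if "t \<ge> max T T'" for t
    proof -
      from T that have all: "list_all2 (\<lambda>h y. gg h t xs = Suc y) gs ys" by simp
      then have "map (\<lambda>h. gg h t xs - 1) gs = ys"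
        by (induction rule: list_all2_induct) auto
      moreover from all have "\<forall>h\<in>set gs. gg h t xs \<noteq> 0"
        by (induction rule: list_all2_induct) auto
      ultimately show ?thesis
        using T' that by (auto simp: g'_def)
    qed
    then show "\<exists>T. \<forall>t\<ge>T. g' t xs = Suc y" by blast
  qed
  then show ?thesis by blast
qed

lemma approximates_prim:
  assumes f: "approximates af gf f n"
    and g: "approximates ag gg g (Suc (Suc n))"
  shows "\<exists>a g'. approximates a g' (RPrim f g) (Suc n)"
proof -
  \<comment> \<open>The accumulator holds an approximate value: a failure 0 is propagated, and a
    success is decremented before it is passed to \<open>ag\<close>. The bound travels along as a
    parameter of the recursion.\<close>
  define h where "h = RComp r_if [RProj 1, RZero,
    RComp ag (RProj 2 # RProj 0 # RComp r_pred [RProj 1] # map RProj [3..<3 + n])]"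
  define a where "a = RComp (RPrim af h) (RProj 1 # RProj 0 # map RProj [2..<2 + n])"
  define v where "v t xs = rec_nat (gf t xs) (\<lambda>i y. if y = 0 then 0 else gg t (i # (y - 1) # xs))"
    for t xs
  have v_Suc: "v t xs (Suc k) = (if v t xs k = 0 then 0 else gg t (k # (v t xs k - 1) # xs))" for t xs k
    by (simp add: v_def)
  have "approximates a (\<lambda>t xs. v t (tl xs) (hd xs)) (RPrim f g) (Suc n)"
  proof (rule approximatesI)
    fix t and xs' :: "nat list" assume "length xs' = Suc n"
    then obtain k xs where xs: "xs' = k # xs" "length xs = n"
      by (cases xs') auto
    have h: "rec_eval h (i # y # t # xs) (if y = 0 then 0 else gg t (i # (y - 1) # xs))" for i y
      unfolding h_def
    proof (intro rec_eval_if' rec_eval.zero rec_eval.comp)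
      show "rec_eval (RProj 1) (i # y # t # xs) y"
        by (simp add: rec_eval_projI)
      show "list_all2 (\<lambda>g. rec_eval g (i # y # t # xs))
          (RProj 2 # RProj 0 # RComp r_pred [RProj 1] # map RProj [3..<3 + n])
          (t # i # (y - 1) # xs)"
        using list_all2_map_proj[of "i # y # t # xs" "[i, y, t]" xs] xs(2)
        by (auto intro!: rec_eval_comp1[OF _ rec_eval_pred[unfolded One_nat_def]]
            simp: numeral_3_eq_3 simp del: upt_Suc)
    qed (simp add: approximatesD(1)[OF g] xs(2))
    have "rec_eval (RPrim af h) (k # t # xs) (v t xs k)"
    proof (induction k)
      case 0
      show ?case
        using approximatesD(1)[OF f xs(2)] by (simp add: v_def rec_eval.prim_0)
    next
      case (Suc k)
      from rec_eval.prim_Suc[OF this h] show ?case by (simp only: v_Suc)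
    qed
    moreover have "list_all2 (\<lambda>g. rec_eval g (t # k # xs))
        (RProj 1 # RProj 0 # map RProj [2..<2 + n]) (k # t # xs)"
      using list_all2_map_proj[of "t # k # xs" "[t, k]" xs] xs
      by (auto simp: numeral_2_eq_2 simp del: upt_Suc)
    ultimately have "rec_eval a (t # k # xs) (v t xs k)"
      unfolding a_def by (rule rec_eval.comp[rotated])
    then show "rec_eval a (t # xs') (v t (tl xs') (hd xs'))"
      by (simp add: xs)
  next
    fix t xs' y assume "length xs' = Suc n" and y: "v t (tl xs') (hd xs') = Suc y"
    then obtain k xs where xs: "xs' = k # xs" "length xs = n"
      by (cases xs') auto
    have "v t xs k = Suc y \<Longrightarrow> rec_eval (RPrim f g) (k # xs) y"
    proof (induction k arbitrary: y)
      case 0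
      then show ?case
        using approximatesD(2)[OF f xs(2)] by (auto simp: v_def intro: rec_eval.prim_0)
    next
      case (Suc k)
      then have "v t xs k \<noteq> 0" "gg t (k # (v t xs k - 1) # xs) = Suc y"
        by (auto simp: v_Suc split: if_splits)
      with Suc.IH[of "v t xs k - 1"] approximatesD(2)[OF g _ this(2)] xs(2) show ?case
        by (auto intro: rec_eval.prim_Suc)
    qed
    with y xs show "rec_eval (RPrim f g) xs' y" by simp
  next
    fix xs' y assume "length xs' = Suc n" and y: "rec_eval (RPrim f g) xs' y"
    then obtain k xs where xs: "xs' = k # xs" "length xs = n"
      by (cases xs') auto
    have "rec_eval (RPrim f g) (k # xs) y \<Longrightarrow> \<exists>T. \<forall>t\<ge>T. v t xs k = Suc y"
    proof (induction k arbitrary: y)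
      case 0
      then have "rec_eval f xs y" by (auto elim: rec_eval_primE)
      from approximatesD(3)[OF f xs(2) this] show ?case by (simp add: v_def)
    next
      case (Suc k)
      then obtain z where z: "rec_eval (RPrim f g) (k # xs) z" "rec_eval g (k # z # xs) y"
        by (auto elim: rec_eval_primE)
      from Suc.IH[OF z(1)] obtain T where T: "\<forall>t\<ge>T. v t xs k = Suc z" by blast
      from approximatesD(3)[OF g _ z(2)] xs(2) obtain T' where T': "\<forall>t\<ge>T'. gg t (k # z # xs) = Suc y"
        by auto
      have "v t xs (Suc k) = Suc y" if "t \<ge> max T T'" for t
        using T T' that by (simp add: v_Suc)
      then show ?case by blast
    qed
    with y xs show "\<exists>T. \<forall>t\<ge>T. v t (tl xs') (hd xs') = Suc y" by simp
  qed
  then show ?thesis by blast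
qed

lemma rec_eval_min_Least:
  assumes "\<And>m. rec_eval f (m # xs) (v m)" "v k = 0"
  shows "rec_eval (RMin f) xs (LEAST m. v m = 0)"
proof (rule rec_eval.min)
  have "v (LEAST m. v m = 0) = 0"
    using assms(2) by (rule LeastI)
  with assms(1) show "rec_eval f ((LEAST m. v m = 0) # xs) 0" by metis
  show "\<forall>m<LEAST m. v m = 0. \<exists>k. rec_eval f (m # xs) (Suc k)"
    using assms(1) not_less_Least by (metis not0_implies_Suc)
qed

lemma approximates_min:
  assumes f: "approximates af gf f (Suc n)"
  shows "\<exists>a g. approximates a g (RMin f) n"
proof -
  text \<open>The bound \<open>t\<close> also limits the search, which makes it total.\<close>
  define q where "q = RComp r_if [RComp r_diff [RProj 0, RProj 1], RZero, RComp r_if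
    [RComp r_pred [RComp af (RProj 1 # RProj 0 # map RProj [2..<2 + n])], RZero, r_const 1]]"
  \<comment> \<open>The search also stops at a missing value, since truncated subtraction identifies
    the outcomes 0 and 1.\<close>
  define qv where "qv t xs u = (if t - u = 0 then 0 else if gf t (u # xs) - 1 = 0 then 0 else 1 :: nat)"
    for t xs u
  define s where "s = RComp r_if [RComp af (RProj 1 # RProj 0 # map RProj [2..<2 + n]), RZero,
    RComp r_if [RComp r_pred [RComp af (RProj 1 # RProj 0 # map RProj [2..<2 + n])],
      RComp RSucc [RProj 0], RZero]]"
  define a where "a = RComp s (RMin q # map RProj [0..<Suc n])"
  define m where "m t xs = (LEAST u. qv t xs u = 0)" for t xs
  \<comment> \<open>The stopping point counts as a result only if the approximation there is 1, that
    is, if the value is known to be 0.\<close>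
  define g where "g t xs = (if gf t (m t xs # xs) = 0 then 0
    else if gf t (m t xs # xs) - 1 = 0 then Suc (m t xs) else 0)" for t xs
  \<comment> \<open>The bound \<open>t\<close> is itself a stopping point, so a least one
    exists.\<close>
  have least: "qv t xs (m t xs) = 0" "\<And>u. u < m t xs \<Longrightarrow> qv t xs u \<noteq> 0" for t xs
    unfolding m_def by (rule LeastI[of _ t], simp add: qv_def) (rule not_less_Least)
  have "approximates a g (RMin f) n"
  proof (rule approximatesI)
    fix t and xs :: "nat list" assume xs: "length xs = n"
    have af: "rec_eval (RComp af (RProj 1 # RProj 0 # map RProj [2..<2 + n])) (u # t # xs)
        (gf t (u # xs))" for u
      by (rule rec_eval.comp[where ys = "t # u # xs"])
        (use list_all2_map_proj[of "u # t # xs" "[u, t]" xs] xs approximatesD(1)[OF f] in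
          \<open>auto simp: numeral_2_eq_2 simp del: upt_Suc\<close>)
    have "rec_eval q (u # t # xs) (qv t xs u)" for u
      unfolding q_def qv_def
      by (intro rec_eval_if' rec_eval.zero rec_eval_comp2[OF _ _ rec_eval_diff]
          rec_eval_comp1[OF af rec_eval_pred] rec_eval_const rec_eval_projI) simp_all
    then have "rec_eval (RMin q) (t # xs) (m t xs)"
      unfolding m_def using least(1) by (rule rec_eval_min_Least)
    then have "list_all2 (\<lambda>g. rec_eval g (t # xs)) (RMin q # map RProj [0..<Suc n]) (m t xs # t # xs)"
      using list_all2_map_proj[of "t # xs" "[]" "t # xs"] xs by simp
    moreover have "rec_eval s (m t xs # t # xs) (g t xs)"
      unfolding s_def g_def
      by (intro rec_eval_if' af rec_eval.zero rec_eval_comp1[OF _ rec_eval.succ]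
          rec_eval_comp1[OF af rec_eval_pred] rec_eval_projI) simp_all
    ultimately show "rec_eval a (t # xs) (g t xs)"
      unfolding a_def by (rule rec_eval.comp)
  next
    fix t xs y assume xs: "length xs = n" and y: "g t xs = Suc y"
    then have 0: "gf t (y # xs) = Suc 0" "m t xs = y"
      by (auto simp: g_def split: if_splits)
    show "rec_eval (RMin f) xs y"
    proof (rule rec_eval.min)
      show "rec_eval f (y # xs) 0"
        using approximatesD(2)[OF f _ 0(1)] xs by simp
      have "\<exists>k. gf t (u # xs) = Suc (Suc k)" if "u < y" for u
        using least(2)[of u t xs] 0(2) that
        by (cases "gf t (u # xs)"; cases "gf t (u # xs) - 1") (auto simp: qv_def split: if_splits)
      then show "\<forall>u<y. \<exists>k. rec_eval f (u # xs) (Suc k)"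
        using approximatesD(2)[OF f] xs by (metis length_Cons)
    qed
  next
    fix xs y assume xs: "length xs = n" and "rec_eval (RMin f) xs y"
    then have y: "rec_eval f (y # xs) 0" "\<forall>u<y. \<exists>k. rec_eval f (u # xs) (Suc k)"
      by (auto elim: rec_eval_minE)
    have "\<exists>T. \<forall>t\<ge>T. \<forall>u<j. gf t (u # xs) > 1" if "j \<le> y" for j
      using that
    proof (induction j)
      case (Suc j)
      then obtain T where T: "\<forall>t\<ge>T. \<forall>u<j. gf t (u # xs) > 1" by auto
      from Suc.prems y(2) have "\<exists>k. rec_eval f (j # xs) (Suc k)" by simp
      then obtain k where "rec_eval f (j # xs) (Suc k)" by blast
      from approximatesD(3)[OF f _ this] xs obtain T' where "\<forall>t\<ge>T'. gf t (j # xs) = Suc (Suc k)"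
        by auto
      with T show ?case
        by (intro exI[of _ "max T T'"]) (auto simp: less_Suc_eq)
    qed simp
    then obtain T where T: "\<forall>t\<ge>T. \<forall>u<y. gf t (u # xs) > 1" by blast
    from approximatesD(3)[OF f _ y(1)] xs obtain T' where T': "\<forall>t\<ge>T'. gf t (y # xs) = Suc 0"
      by auto
    \<comment> \<open>A bound beyond \<open>y\<close> keeps the cut-off from stopping the search too
      early.\<close>
    have "g t xs = Suc y" if t: "t \<ge> max (Suc y) (max T T')" for t
    proof -
      have "m t xs = y"
        unfolding m_def
      proof (rule Least_equality)
        show "qv t xs y = 0"
          using T' t by (simp add: qv_def)
        fix u assume "qv t xs u = 0"
        moreover have "qv t xs u \<noteq> 0" if "u < y"
          using T t that by (fastforce simp: qv_def)
        ultimately show "y \<le> u" using not_le_imp_less by blast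
      qed
      with T' t show ?thesis by (simp add: g_def)
    qed
    then show "\<exists>T. \<forall>t\<ge>T. g t xs = Suc y" by blast
  qed
  then show ?thesis by blast
qed

text \<open>Induction for all arities at once, because terms carry none and the subterms are applied
  to argument lists of other lengths.\<close>

lemma ex_approximates: "\<exists>a g. approximates a g r n"
proof (induction r arbitrary: n)
  case RZero
  have "approximates (r_const 1) (\<lambda>_ _. 1) RZero n"
    by (rule approximatesI) (use rec_eval_const[of 1] in \<open>auto elim: rec_eval_zeroE intro: rec_eval.zero\<close>)
  then show ?case by blast
next
  case RSucc
  show ?case
  proof (cases "n = 1")
    case True
    have "approximates (RComp RSucc [RComp RSucc [RProj 1]]) (\<lambda>_ xs. Suc (Suc (hd xs))) RSucc n"
      by (rule approximatesI)
        (auto simp: True length_Suc_conv elim!: rec_eval_succE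
          intro!: rec_eval_comp1[OF _ rec_eval.succ] rec_eval_projI rec_eval.succ)
    then show ?thesis by blast
  next
    case False
    then have "approximates RZero (\<lambda>_ _. 0) RSucc n"
      by (intro approximates_undefined) (auto elim: rec_eval_succE)
    then show ?thesis by blast
  qed
next
  case (RProj i)
  show ?case
  proof (cases "i < n")
    case True
    have "approximates (RComp RSucc [RProj (Suc i)]) (\<lambda>_ xs. Suc (xs ! i)) (RProj i) n"
      by (rule approximatesI)
        (use True in \<open>auto elim!: rec_eval_projE
          intro!: rec_eval_comp1[OF _ rec_eval.succ] rec_eval_projI\<close>)
    then show ?thesis by blast
  next
    case False
    then have "approximates RZero (\<lambda>_ _. 0) (RProj i) n"
      by (intro approximates_undefined) (auto elim: rec_eval_projE)
    then show ?thesis by blast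
  qed
next
  case (RComp f gs)
  obtain af gf where "approximates af gf f (length gs)"
    using RComp.IH(1) by blast
  moreover have "\<forall>h. \<exists>a. h \<in> set gs \<longrightarrow> (\<exists>g. approximates a g h n)"
    using RComp.IH(2) by blast
  then obtain ag where "\<forall>h\<in>set gs. \<exists>g. approximates (ag h) g h n"
    by metis
  then obtain gg where "\<forall>h\<in>set gs. approximates (ag h) (gg h) h n"
    by metis
  ultimately show ?case
    by (intro approximates_comp) auto
next
  case (RPrim f g)
  show ?case
  proof (cases n)
    case 0
    then have "approximates RZero (\<lambda>_ _. 0) (RPrim f g) n"
      by (intro approximates_undefined) (auto elim: rec_eval_primE)
    then show ?thesis by blast
  next
    case (Suc m)
    with RPrim.IH show ?thesis using approximates_prim by metis
  qed
next
  case (RMin f)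
  then show ?case using approximates_min by metis
qed

section \<open>Undecidability\<close>

text \<open>The formula \<alpha> is built from \<open>r\<close> before any input is fixed, so its
  code can be supplied as the second input; this takes the place of the recursion theorem. As
  \<open>L\<close> lies between the two logics, either outcome settles membership in
  \<open>L\<close>.\<close>

lemma ex_self_code:
  assumes "ACT_meet \<subseteq> L" "L \<subseteq> ACT_omega_meet"
  shows "\<exists>c. \<forall>x. (rec_eval r [x, c] 0 \<longrightarrow> self_code x c \<in> sequent_code ` L) \<and>
    (rec_eval r [x, c] 1 \<longrightarrow> self_code x c \<notin> sequent_code ` L)"
proof -
  obtain \<alpha> where \<alpha>: "rec_eval r [x, y] 0 \<Longrightarrow> run_sequent \<alpha> x y \<in> ACT_meet"
    "rec_eval r [x, y] 1 \<Longrightarrow> run_sequent \<alpha> x y \<notin> ACT_omega_meet" for x y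
    using ex_program_form[of r] by blast
  have "self_code x (form_code \<alpha>) \<in> sequent_code ` L \<longleftrightarrow> run_sequent \<alpha> x (form_code \<alpha>) \<in> L" for x
    using bij_is_inj[OF bij_sequent_code]
    by (simp add: inj_image_mem_iff flip: sequent_code_run_sequent)
  with \<alpha> assms show ?thesis
    by (intro exI[of _ "form_code \<alpha>"]) blast
qed

text \<open>A decider applied to the sequent of its own program answers 0 if that sequent lies
  outside \<open>L\<close>, but output 0 forces it into \<open>L\<close>; dually for 1.\<close>

theorem undecidable_between:
  assumes "ACT_meet \<subseteq> L" "L \<subseteq> ACT_omega_meet"
  shows "\<not> decidable (sequent_code ` L)"
proof
  assume "decidable (sequent_code ` L)"
  then obtain r where r: "rec_eval r [x] (if x \<in> sequent_code ` L then 1 else 0)" for x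
    unfolding decidable_def total_recursive_def by blast
  have eval: "rec_eval (RComp r [r_self_code]) [x, c]
      (if self_code x c \<in> sequent_code ` L then 1 else 0)" for x c
    by (rule rec_eval_comp1[OF rec_eval_self_code r])
  obtain c where c: "\<And>x. (rec_eval (RComp r [r_self_code]) [x, c] 0 \<longrightarrow> self_code x c \<in> sequent_code ` L) \<and>
    (rec_eval (RComp r [r_self_code]) [x, c] 1 \<longrightarrow> self_code x c \<notin> sequent_code ` L)"
    using ex_self_code[OF assms] by blast
  show False
    using c[of 0] eval[of 0 c] by (auto split: if_splits)
qed

text \<open>The reduction maps \<open>x\<close> to \<open>self_code x c\<close>, where
  \<open>c\<close> is fixed by a program that searches \<open>A\<close> and \<open>L\<close> in
  parallel.\<close>

theorem many_one_reducible_between: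
  assumes L: "ACT_meet \<subseteq> L" "L \<subseteq> ACT_omega_meet"
    and re: "recursively_enumerable (sequent_code ` L)" "recursively_enumerable A"
  shows "many_one_reducible A (sequent_code ` L)"
proof -
  let ?C = "sequent_code ` L"
  obtain rL rA where rL: "?C = {x. \<exists>y. rec_eval rL [x] y}" and rA: "A = {x. \<exists>y. rec_eval rA [x] y}"
    using re by (auto simp: recursively_enumerable_def)
  obtain aL gL aA gA where gL: "approximates aL gL rL 1" and gA: "approximates aA gA rA 1"
    using ex_approximates by metis
  have memL: "x \<in> ?C \<longleftrightarrow> (\<exists>t. gL t [x] \<noteq> 0)" for x
    unfolding rL mem_Collect_eq by (rule approximates_converges_iff[OF gL]) simp
  have memA: "x \<in> A \<longleftrightarrow> (\<exists>t. gA t [x] \<noteq> 0)" for x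
    unfolding rA mem_Collect_eq by (rule approximates_converges_iff[OF gA]) simp
  text \<open>The program waits until \<open>x\<close> shows up in \<open>A\<close> or its own code on input \<open>x\<close> shows up in \<open>L\<close>, and
    then contradicts the second alternative. Hence only the first one can occur.\<close>
  define q where "q = RComp r_if [RComp aA [RProj 0, RProj 1], RComp r_if
    [RComp aL [RProj 0, RComp r_self_code [RProj 1, RProj 2]], r_const 1, RZero], RZero]"
  define qv where "qv x c t = (if gA t [x] = 0 then if gL t [self_code x c] = 0 then 1 else 0 else 0 :: nat)"
    for x c t
  define r where "r = RComp (RComp r_if [aA, r_const 1, RZero]) [RMin q, RProj 0]"
  have q: "rec_eval q [t, x, c] (qv x c t)" for t x c
  proof -
    have "rec_eval (RComp aA [RProj 0, RProj 1]) [t, x, c] (gA t [x])"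
      by (rule rec_eval_comp2[OF rec_eval_projI rec_eval_projI approximatesD(1)[OF gA]]) simp_all
    moreover have "rec_eval (RComp r_self_code [RProj 1, RProj 2]) [t, x, c] (self_code x c)"
      by (rule rec_eval_comp2[OF rec_eval_projI rec_eval_projI rec_eval_self_code]) simp_all
    then have "rec_eval (RComp aL [RProj 0, RComp r_self_code [RProj 1, RProj 2]]) [t, x, c]
        (gL t [self_code x c])"
      by (rule rec_eval_comp2[OF rec_eval_projI _ approximatesD(1)[OF gL], rotated 2]) simp_all
    ultimately show ?thesis
      unfolding q_def qv_def by (intro rec_eval_if' rec_eval.zero rec_eval_const)
  qed
  \<comment> \<open>At the stopping time \<open>A\<close> has priority: the output is 0 if
    \<open>x\<close> was found in \<open>A\<close>, and 1 if only the code of the own sequent was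
    found in \<open>L\<close>.\<close>
  have r: "rec_eval r [x, c] (if gA (LEAST t. qv x c t = 0) [x] = 0 then 1 else 0)"
    if "qv x c t = 0" for x c t
  proof -
    have "rec_eval (RMin q) [x, c] (LEAST t. qv x c t = 0)"
      using q that by (rule rec_eval_min_Least)
    moreover have "rec_eval (RComp r_if [aA, r_const 1, RZero]) [t, x] (if gA t [x] = 0 then 1 else 0)" for t
      by (intro rec_eval_if' rec_eval.zero rec_eval_const approximatesD(1)[OF gA]) simp
    ultimately show ?thesis
      unfolding r_def using rec_eval_comp2[OF _ rec_eval_projI] by simp
  qed
  obtain c where c: "\<And>x. rec_eval r [x, c] 0 \<Longrightarrow> self_code x c \<in> ?C"
    "\<And>x. rec_eval r [x, c] 1 \<Longrightarrow> self_code x c \<notin> ?C"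
    using ex_self_code[OF L] by blast
  have found: "x \<in> A \<and> self_code x c \<in> ?C" if t: "qv x c t = 0" for x t
  proof -
    define n where "n = (LEAST t. qv x c t = 0)"
    have n: "qv x c n = 0"
      unfolding n_def using t by (rule LeastI)
    have eval: "rec_eval r [x, c] (if gA n [x] = 0 then 1 else 0)"
      using r[OF t] by (simp add: n_def)
    show ?thesis
    proof (cases "gA n [x] = 0")
      case True
      then have "self_code x c \<notin> ?C"
        using c(2) eval by simp
      moreover have "gL n [self_code x c] \<noteq> 0"
        using n True by (auto simp: qv_def split: if_splits)
      ultimately show ?thesis
        using memL by blast
    next
      case False
      then show ?thesis
        using c(1) eval memA by auto
    qed
  qed
  have "x \<in> A \<longleftrightarrow> self_code x c \<in> ?C" for x
  proof
    assume "x \<in> A"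
    then obtain t where "gA t [x] \<noteq> 0" by (auto simp: memA)
    then show "self_code x c \<in> ?C"
      using found[of x t] by (simp add: qv_def)
  next
    assume "self_code x c \<in> ?C"
    then obtain t where "gL t [self_code x c] \<noteq> 0" unfolding memL by blast
    then show "x \<in> A"
      using found[of x t] by (simp add: qv_def)
  qed
  moreover have "total_recursive (\<lambda>x. self_code x c)"
    by (rule total_recursiveI[of "RComp r_self_code [RProj 0, r_const c]"])
      (auto intro: rec_eval_comp2[OF _ rec_eval_const rec_eval_self_code] rec_eval_projI)
  ultimately show ?thesis
    unfolding many_one_reducible_def by blast
qed

theorem theorem7:
  fixes L :: "sequent set"
  assumes "\<forall>s\<in>L. join_free s"
    and "ACT_meet \<subseteq> L"
    and "L \<subseteq> ACT_omega_meet"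
  shows "\<not> decidable (sequent_code ` L) \<and>
    (recursively_enumerable (sequent_code ` L) \<longrightarrow> Sigma_0_1_complete (sequent_code ` L))"
  using undecidable_between[OF assms(2,3)] many_one_reducible_between[OF assms(2,3)]
  by (simp add: Sigma_0_1_complete_def)

end
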